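(* Let $n\ge1$ and let $\{\cdot,\cdot\}$ be the Poisson bracket on $\mathbb{S}^{2n}=\{(a_1,\dots,a_n,t)\in\mathbb{C}^n\times\mathbb{R}:\sum_i|a_i|^2=t(1-t)\}$ given by $$\{a_k,a_\ell\}=a_ka_\ell\ (k<\ell),\quad \{a_k,a_\ell^*\}=-3a_ka_\ell^*\ (k\ne\ell),\quad \{a_i,t\}=-2a_it,\quad \{a_k,a_k^*\}=2t^2+2\sum_{\ell<k}a_\ell a_\ell^*-2a_ka_k^*.$$ There are two distinct symplectic leaves in $(\mathbb{S}^{2n},\{\cdot,\cdot\})$: (i) a zero-dimensional leaf given by the north pole $P_N=(a_i=0,\,t=0)$; (ii) $\mathbb{R}^{2n}=\mathbb{S}^{2n}\setminus\{P_N\}$. In the complex coordinates $z_i=a_i/t$ on $\mathbb{R}^{2n}=\mathbb{S}^{2n}\setminus\{P_N\}$, the Poisson brackets read $$\{z_k,z_\ell\}=z_kz_\ell\ \ (k<\ell),\qquad \{z_k,z_\ell^*\}=z_kz_\ell^*\ \ (k\neq\ell),\qquad \{z_k,z_k^*\}=2\Big(1+\sum_{\ell\le k}z_\ell z_\ell^*\Big).$$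
   Context: $^*$ denotes complex conjugation of functions. Poisson brackets are taken on complex-valued functions: they are $\mathbb{C}$-bilinear, antisymmetric, satisfy the Leibniz and Jacobi identities, and obey the reality convention $\{f^*,g^*\}=-\{f,g\}^*$ (that is, the bracket is the imaginary unit times a real Poisson bracket; this determines the brackets not listed, e.g. $\{a_i^*,t\}=2a_i^*t$). The symplectic leaves are those of the corresponding real Poisson bivector. *)

theory Defs
  imports "HOL-Analysis.Analysis"
begin

section \<open>Smooth maps on subsets of Euclidean spaces\<close>

primrec Ck_on :: "nat \<Rightarrow> 'a::euclidean_space set \<Rightarrow> ('a \<Rightarrow> 'b::real_normed_vector) \<Rightarrow> bool" where
  "Ck_on 0 V f \<longleftrightarrow> continuous_on V f"
| "Ck_on (Suc k) V f \<longleftrightarrow>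
     (\<forall>x\<in>V. f differentiable (at x)) \<and> (\<forall>v. Ck_on k V (\<lambda>x. frechet_derivative f (at x) v))"

text \<open>Only the values of \<open>f\<close> on \<open>M\<close> matter. For an embedded submanifold \<open>M\<close> this is
  smoothness in the sense of the manifold structure of \<open>M\<close>.\<close>

definition smooth_on :: "'a::euclidean_space set \<Rightarrow> ('a \<Rightarrow> 'b::real_normed_vector) \<Rightarrow> bool" where
  "smooth_on M f \<longleftrightarrow>
     (\<forall>x\<in>M. \<exists>V F. open V \<and> x \<in> V \<and> (\<forall>k. Ck_on k V F) \<and> (\<forall>y\<in>M \<inter> V. F y = f y))"

definition diffeomorphism_between ::
  "'a::euclidean_space set \<Rightarrow> 'b::euclidean_space set \<Rightarrow> ('a \<Rightarrow> 'b) \<Rightarrow> bool" where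
  "diffeomorphism_between M N f \<longleftrightarrow>
     bij_betw f M N \<and> smooth_on M f \<and> smooth_on N (the_inv_into M f)"


section \<open>Poisson brackets on complex-valued functions\<close>

text \<open>Throughout, \<open>M\<close> is (the underlying set of) an embedded submanifold of a Euclidean space.
  Elements of \<open>C\<^sup>\<infinity>(M, \<complex>)\<close> are represented by total functions of which only the values on
  \<open>M\<close> are relevant; the second clause below says that a bracket respects this. Linearity and the
  Leibniz rule in the second argument follow from antisymmetry.\<close>

definition poisson_bracket_on ::
  "'a::euclidean_space set \<Rightarrow> (('a \<Rightarrow> complex) \<Rightarrow> ('a \<Rightarrow> complex) \<Rightarrow> 'a \<Rightarrow> complex) \<Rightarrow> bool" where
  "poisson_bracket_on M br \<longleftrightarrow>
     (\<forall>f g. smooth_on M f \<longrightarrow> smooth_on M g \<longrightarrow> smooth_on M (br f g)) \<and>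
     (\<forall>f f' g g'. smooth_on M f \<longrightarrow> smooth_on M g \<longrightarrow>
        (\<forall>x\<in>M. f x = f' x) \<longrightarrow> (\<forall>x\<in>M. g x = g' x) \<longrightarrow>
        (\<forall>x\<in>M. br f g x = br f' g' x)) \<and>
     (\<forall>f g h c. smooth_on M f \<longrightarrow> smooth_on M g \<longrightarrow> smooth_on M h \<longrightarrow>
        (\<forall>x\<in>M. br (\<lambda>y. c * f y + g y) h x = c * br f h x + br g h x)) \<and>
     (\<forall>f g. smooth_on M f \<longrightarrow> smooth_on M g \<longrightarrow>
        (\<forall>x\<in>M. br f g x = - br g f x)) \<and>
     (\<forall>f g h. smooth_on M f \<longrightarrow> smooth_on M g \<longrightarrow> smooth_on M h \<longrightarrow>
        (\<forall>x\<in>M. br (\<lambda>y. f y * g y) h x = f x * br g h x + br f h x * g x)) \<and>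
     (\<forall>f g h. smooth_on M f \<longrightarrow> smooth_on M g \<longrightarrow> smooth_on M h \<longrightarrow>
        (\<forall>x\<in>M. br f (br g h) x + br g (br h f) x + br h (br f g) x = 0)) \<and>
     (\<forall>f g. smooth_on M f \<longrightarrow> smooth_on M g \<longrightarrow>
        (\<forall>x\<in>M. br (\<lambda>y. cnj (f y)) (\<lambda>y. cnj (g y)) x = - cnj (br f g x)))"

text \<open>The bracket of functions that are only defined on a relatively open subset of \<open>M\<close>, evaluated
  at a point \<open>x\<close> of that subset: brackets are local, so one may replace the functions by global
  smooth functions with the same germ at \<open>x\<close>.\<close>

definition local_bracket ::
  "'a::euclidean_space set \<Rightarrow> (('a \<Rightarrow> complex) \<Rightarrow> ('a \<Rightarrow> complex) \<Rightarrow> 'a \<Rightarrow> complex)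
     \<Rightarrow> ('a \<Rightarrow> complex) \<Rightarrow> ('a \<Rightarrow> complex) \<Rightarrow> 'a \<Rightarrow> complex" where
  "local_bracket M br f g x =
     (THE c. \<exists>F G V. smooth_on M F \<and> smooth_on M G \<and> open V \<and> x \<in> V \<and>
        (\<forall>y\<in>M \<inter> V. F y = f y \<and> G y = g y) \<and> c = br F G x)"


section \<open>Symplectic leaves\<close>

text \<open>By the reality convention, \<open>br\<close> is \<open>\<i>\<close> times a real Poisson bracket, namely
  \<open>{f, g}\<^sub>\<real> = - \<i> * br f g\<close> on real functions.\<close>

definition smooth_real_on :: "'a::euclidean_space set \<Rightarrow> ('a \<Rightarrow> complex) \<Rightarrow> bool" where
  "smooth_real_on M h \<longleftrightarrow> smooth_on M h \<and> (\<forall>x\<in>M. h x \<in> \<real>)"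

text \<open>The Hamiltonian vector field \<open>{\<cdot>, h}\<^sub>\<real>\<close> on \<open>M\<close>, as a vector of the ambient
  Euclidean space: its components are its values on the Cartesian coordinate functions.\<close>

definition hamiltonian_vector ::
  "(('a::euclidean_space \<Rightarrow> complex) \<Rightarrow> ('a \<Rightarrow> complex) \<Rightarrow> 'a \<Rightarrow> complex)
     \<Rightarrow> ('a \<Rightarrow> complex) \<Rightarrow> 'a \<Rightarrow> 'a" where
  "hamiltonian_vector br h x =
     (\<Sum>b\<in>Basis. Re (- \<i> * br (\<lambda>y. complex_of_real (y \<bullet> b)) h x) *\<^sub>R b)"

definition hamiltonian_arc ::
  "'a::euclidean_space set \<Rightarrow> (('a \<Rightarrow> complex) \<Rightarrow> ('a \<Rightarrow> complex) \<Rightarrow> 'a \<Rightarrow> complex)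
     \<Rightarrow> 'a \<Rightarrow> 'a \<Rightarrow> bool" where
  "hamiltonian_arc M br p q \<longleftrightarrow>
     (\<exists>h c a b. smooth_real_on M h \<and> a \<le> b \<and> c a = p \<and> c b = q \<and>
        (\<forall>s\<in>{a..b}. c s \<in> M \<and>
           (c has_vector_derivative hamiltonian_vector br h (c s)) (at s within {a..b})))"

text \<open>The symplectic leaves are the classes of points that can be joined by a piecewise smooth path
  whose pieces are integral curves of Hamiltonian vector fields.\<close>

definition leaf_relation ::
  "'a::euclidean_space set \<Rightarrow> (('a \<Rightarrow> complex) \<Rightarrow> ('a \<Rightarrow> complex) \<Rightarrow> 'a \<Rightarrow> complex)
     \<Rightarrow> ('a \<times> 'a) set" where
  "leaf_relation M br = {(p, q). p \<in> M \<and> q \<in> M \<and> (hamiltonian_arc M br)\<^sup>*\<^sup>* p q}"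

definition symplectic_leaves ::
  "'a::euclidean_space set \<Rightarrow> (('a \<Rightarrow> complex) \<Rightarrow> ('a \<Rightarrow> complex) \<Rightarrow> 'a \<Rightarrow> complex)
     \<Rightarrow> 'a set set" where
  "symplectic_leaves M br = M // leaf_relation M br"

text \<open>The tangent space of a leaf at one of its points is spanned by the Hamiltonian vector fields.\<close>

definition leaf_dimension ::
  "'a::euclidean_space set \<Rightarrow> (('a \<Rightarrow> complex) \<Rightarrow> ('a \<Rightarrow> complex) \<Rightarrow> 'a \<Rightarrow> complex)
     \<Rightarrow> 'a set \<Rightarrow> nat \<Rightarrow> bool" where
  "leaf_dimension M br L d \<longleftrightarrow>
     (\<forall>x\<in>L. dim {hamiltonian_vector br h x |h. smooth_real_on M h} = d)"


section \<open>The sphere and its coordinates\<close>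

text \<open>The indices \<open>1 < \<dots> < n\<close> are the elements of a finite linearly ordered type \<open>'n\<close> with
  \<open>n = CARD('n)\<close>; types being nonempty, \<open>n \<ge> 1\<close>.\<close>

definition even_sphere :: "((complex ^ 'n::finite) \<times> real) set" where
  "even_sphere = {x. (\<Sum>i\<in>UNIV. (cmod (fst x $ i))\<^sup>2) = snd x * (1 - snd x)}"

definition north_pole :: "(complex ^ 'n::finite) \<times> real" where
  "north_pole = (0, 0)"

definition coord_a :: "'n::finite \<Rightarrow> (complex ^ 'n) \<times> real \<Rightarrow> complex" where
  "coord_a i x = fst x $ i"

definition coord_a_star :: "'n::finite \<Rightarrow> (complex ^ 'n) \<times> real \<Rightarrow> complex" where
  "coord_a_star i x = cnj (coord_a i x)"

definition coord_t :: "(complex ^ 'n::finite) \<times> real \<Rightarrow> complex" where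
  "coord_t x = complex_of_real (snd x)"

definition coord_z :: "'n::finite \<Rightarrow> (complex ^ 'n) \<times> real \<Rightarrow> complex" where
  "coord_z i x = coord_a i x / coord_t x"

definition coord_z_star :: "'n::finite \<Rightarrow> (complex ^ 'n) \<times> real \<Rightarrow> complex" where
  "coord_z_star i x = cnj (coord_z i x)"

end

theory Submission
  imports Defs
begin

text \<open>
  Write \<open>N\<close> for the pole. The statement combines three facts about Hamiltonian vector fields with
  one computation in the chart \<open>z = a / t\<close>.

  \<^item> A bracket \<open>{h, f}\<close> at a point depends on \<open>h\<close> only through its first derivatives there,
    \<open>{h, f} = \<Sum> \<partial>h/\<partial>y\<^sub>b {y\<^sub>b, f}\<close> with the Cartesian coordinates \<open>y\<^sub>b\<close> (\<open>br_chain\<close>). Brackets are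
    local because of bump functions (\<open>br_local\<close>), and Hadamard's lemma (\<open>hadamard\<close>) then reduces
    \<open>h\<close> to first order. So the listed brackets of the coordinates decide everything.

  \<^item> At \<open>N\<close> all brackets of coordinates vanish, hence so do all Hamiltonian vector fields. A smooth
    field is Lipschitz at its zero, and by Gronwall's argument its integral curves can neither leave
    nor reach the zero (\<open>hamiltonian_arc_singular\<close>). So \<open>{N}\<close> is a leaf, of dimension 0.

  \<^item> Away from \<open>N\<close> there are enough explicit integral curves. If \<open>z\<^sub>j = 0\<close> for all \<open>j > k\<close>, the
    linear function \<open>h = Im (a\<^sub>k w\<^sup>*)\<close> moves the point with \<open>z\<^sub>k = s w\<close> along the ray
    \<open>s \<mapsto> s w\<close> and fixes every other \<open>z\<^sub>j\<close> (\<open>radial_arc\<close>). The reason: in the chart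
    \<open>h = t Im (z\<^sub>k w\<^sup>*)\<close>, and \<open>Im (z\<^sub>k w\<^sup>*)\<close> vanishes on the ray, so the derivatives of \<open>t\<close> drop
    out; for \<open>j < k\<close> the bracket with \<open>z\<^sub>j\<close> is proportional to \<open>Im (z\<^sub>k w\<^sup>*)\<close>, and for
    \<open>j > k\<close> to \<open>z\<^sub>j = 0\<close>; and the speed is right since \<open>t\<close> is the inverse of
    \<open>1 + \<Sum>\<^bsub>l\<le>k\<^esub> |z\<^sub>l|\<^sup>2\<close>. Switching the coordinates on one after the other, from the first to the
    last, reaches every point from \<open>z = 0\<close> (\<open>arcs_from_origin\<close>). As \<open>h\<close> is linear in the ambient
    coordinates, it is smooth on the whole sphere, including \<open>N\<close>.

  The dimension of the big leaf is a rank computation: a covector that annihilates all Hamiltonian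
  vectors at a point other than \<open>N\<close> is a multiple of the normal covector of the sphere, by a
  triangular elimination along the order of the indices (\<open>annihilator_of_brackets\<close>). The brackets of
  the \<open>z\<^sub>k\<close> follow from the quotient rule (\<open>local_quotient_bracket\<close>).
\<close>

section \<open>Calculus of infinitely differentiable maps on open sets\<close>

abbreviation Cinf_on :: "'a::euclidean_space set \<Rightarrow> ('a \<Rightarrow> 'b::real_normed_vector) \<Rightarrow> bool" where
  "Cinf_on V f \<equiv> \<forall>k. Ck_on k V f"

lemma Ck_on_SucD: "Ck_on (Suc k) V f \<Longrightarrow> Ck_on k V f"
proof (induction k arbitrary: f)
  case 0
  then show ?case
    by (auto intro!: continuous_at_imp_continuous_on differentiable_imp_continuous_within)
next
  case (Suc k)
  then show ?case by simp
qed

lemma Ck_on_subset: "Ck_on k V f \<Longrightarrow> U \<subseteq> V \<Longrightarrow> Ck_on k U f"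
  by (induction k arbitrary: f) (auto intro: continuous_on_subset)

lemma Ck_on_Un:
  assumes "open U" "open V"
  shows "Ck_on k U f \<Longrightarrow> Ck_on k V f \<Longrightarrow> Ck_on k (U \<union> V) f"
  by (induction k arbitrary: f) (auto intro: continuous_on_open_Un assms)

lemma frechet_derivative_cong_open:
  assumes "open V" "x \<in> V" "\<And>y. y \<in> V \<Longrightarrow> f y = g y"
  shows "frechet_derivative f (at x) = frechet_derivative g (at x)"
proof -
  have "(f has_derivative D) (at x) \<longleftrightarrow> (g has_derivative D) (at x)" for D
    using has_derivative_transform_within_open[OF _ assms(1,2), of f D UNIV g]
      has_derivative_transform_within_open[OF _ assms(1,2), of g D UNIV f] assms(3) by auto
  then show ?thesis by (simp add: frechet_derivative_def)
qed

lemma Ck_on_cong: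
  assumes "open V"
  shows "(\<And>y. y \<in> V \<Longrightarrow> f y = g y) \<Longrightarrow> Ck_on k V f \<longleftrightarrow> Ck_on k V g"
proof (induction k arbitrary: f g)
  case 0
  then show ?case by (auto cong: continuous_on_cong)
next
  case (Suc k)
  have "f differentiable (at x) \<longleftrightarrow> g differentiable (at x)" if "x \<in> V" for x
    using Suc.prems assms that
    by (metis differentiable_def has_derivative_transform_within_open)
  moreover have "Ck_on k V (\<lambda>x. frechet_derivative f (at x) v)
      \<longleftrightarrow> Ck_on k V (\<lambda>x. frechet_derivative g (at x) v)" for v
    by (rule Suc.IH) (metis frechet_derivative_cong_open assms Suc.prems)
  ultimately show ?case by auto
qed

text \<open>The recursive definition speaks of \<^const>\<open>frechet_derivative\<close>; these two rules replace it by
  any derivative on the open set \<open>V\<close>; the closure properties below rest on them.\<close>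

lemma Ck_on_SucI:
  assumes "open V" "\<And>x. x \<in> V \<Longrightarrow> (f has_derivative f' x) (at x)"
    and "\<And>v. Ck_on k V (\<lambda>x. f' x v)"
  shows "Ck_on (Suc k) V f"
proof -
  have "frechet_derivative f (at x) = f' x" if "x \<in> V" for x
    using frechet_derivative_at[OF assms(2)[OF that]] by simp
  then have "Ck_on k V (\<lambda>x. frechet_derivative f (at x) v)" for v
    using Ck_on_cong[OF assms(1), of "\<lambda>x. frechet_derivative f (at x) v" "\<lambda>x. f' x v" k] assms(3) by auto
  then show ?thesis using assms(2) by (auto simp: differentiable_def)
qed

lemma Ck_on_SucE:
  assumes "Ck_on (Suc k) V f"
  obtains f' where "\<And>x. x \<in> V \<Longrightarrow> (f has_derivative f' x) (at x)" "\<And>v. Ck_on k V (\<lambda>x. f' x v)"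
  using assms that[of "\<lambda>x. frechet_derivative f (at x)"] by (auto simp: frechet_derivative_works)

lemma Ck_on_const: "open V \<Longrightarrow> Ck_on k V (\<lambda>x. c)"
proof (induction k arbitrary: c)
  case 0 then show ?case by simp
next
  case (Suc k)
  then show ?case by (intro Ck_on_SucI[where f'="\<lambda>x v. 0"]) auto
qed

lemma Ck_on_add:
  assumes "open V"
  shows "Ck_on k V f \<Longrightarrow> Ck_on k V g \<Longrightarrow> Ck_on k V (\<lambda>x. f x + g x)"
proof (induction k arbitrary: f g)
  case 0 then show ?case by (simp add: continuous_on_add)
next
  case (Suc k)
  obtain f' where f': "\<And>x. x \<in> V \<Longrightarrow> (f has_derivative f' x) (at x)" "\<And>v. Ck_on k V (\<lambda>x. f' x v)"
    using Ck_on_SucE[OF Suc.prems(1)] by metis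
  obtain g' where g': "\<And>x. x \<in> V \<Longrightarrow> (g has_derivative g' x) (at x)" "\<And>v. Ck_on k V (\<lambda>x. g' x v)"
    using Ck_on_SucE[OF Suc.prems(2)] by metis
  show ?case
    by (rule Ck_on_SucI[OF assms has_derivative_add[OF f'(1) g'(1)]]) (auto intro: Suc.IH f' g')
qed

lemma Ck_on_sum:
  assumes "open V" "\<And>i. i \<in> I \<Longrightarrow> Ck_on k V (f i)"
  shows "Ck_on k V (\<lambda>x. \<Sum>i\<in>I. f i x)"
  using assms(2) by (induction I rule: infinite_finite_induct)
    (auto intro: Ck_on_add Ck_on_const assms(1))

lemma Ck_on_bounded_linear:
  assumes "open V" "bounded_linear T"
  shows "Ck_on k V f \<Longrightarrow> Ck_on k V (\<lambda>x. T (f x))"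
proof (induction k arbitrary: f)
  case 0 then show ?case
    by (simp add: bounded_linear.continuous_on[OF assms(2)])
next
  case (Suc k)
  obtain f' where f': "\<And>x. x \<in> V \<Longrightarrow> (f has_derivative f' x) (at x)" "\<And>v. Ck_on k V (\<lambda>x. f' x v)"
    using Ck_on_SucE[OF Suc.prems(1)] by metis
  show ?case
    by (rule Ck_on_SucI[OF assms(1) bounded_linear.has_derivative[OF assms(2) f'(1)]])
      (auto intro: Suc.IH f')
qed

lemma Ck_on_bilinear:
  assumes "open V" "bounded_bilinear T"
  shows "Ck_on k V f \<Longrightarrow> Ck_on k V g \<Longrightarrow> Ck_on k V (\<lambda>x. T (f x) (g x))"
proof (induction k arbitrary: f g)
  case 0 then show ?case by (simp add: bounded_bilinear.continuous_on[OF assms(2)])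
next
  case (Suc k)
  obtain f' where f': "\<And>x. x \<in> V \<Longrightarrow> (f has_derivative f' x) (at x)" "\<And>v. Ck_on k V (\<lambda>x. f' x v)"
    using Ck_on_SucE[OF Suc.prems(1)] by metis
  obtain g' where g': "\<And>x. x \<in> V \<Longrightarrow> (g has_derivative g' x) (at x)" "\<And>v. Ck_on k V (\<lambda>x. g' x v)"
    using Ck_on_SucE[OF Suc.prems(2)] by metis
  show ?case
    by (rule Ck_on_SucI[OF assms(1) bounded_bilinear.FDERIV[OF assms(2) f'(1) g'(1)]])
      (auto intro!: Suc.IH Ck_on_add f' g' Ck_on_SucD[OF Suc.prems(1)] Ck_on_SucD[OF Suc.prems(2)] assms(1))
qed

lemmas Ck_on_scaleR = Ck_on_bilinear[OF _ bounded_bilinear_scaleR]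
lemmas Ck_on_mult = Ck_on_bilinear[OF _ bounded_bilinear_mult]
lemmas Ck_on_inner = Ck_on_bilinear[OF _ bounded_bilinear_inner]

lemma Ck_on_linear: 
  assumes "open V" "bounded_linear T" shows "Ck_on k V T"
proof (cases k)
  case 0 then show ?thesis
    using assms(2) by (simp add: linear_continuous_on)
next
  case (Suc m)
  show ?thesis unfolding Suc
    by (rule Ck_on_SucI[OF assms(1) bounded_linear_imp_has_derivative[OF assms(2)]])
      (rule Ck_on_const[OF assms(1)])
qed

text \<open>Expanding the inner derivative in the basis turns the chain rule into a finite sum of products of
  functions of the same kind, so that the induction on the order closes.\<close>

lemma Ck_on_compose:
  fixes f :: "'a::euclidean_space \<Rightarrow> 'b::euclidean_space" and g :: "'b \<Rightarrow> 'c::real_normed_vector"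
  assumes "open V" "open W" "f ` V \<subseteq> W"
  shows "Ck_on k V f \<Longrightarrow> Ck_on k W g \<Longrightarrow> Ck_on k V (\<lambda>x. g (f x))"
proof (induction k arbitrary: g)
  case 0 then show ?case using assms(3) by (auto intro: continuous_on_compose2)
next
  case (Suc k)
  obtain f' where f': "\<And>x. x \<in> V \<Longrightarrow> (f has_derivative f' x) (at x)" "\<And>v. Ck_on k V (\<lambda>x. f' x v)"
    using Ck_on_SucE[OF Suc.prems(1)] by metis
  obtain g' where g': "\<And>x. x \<in> W \<Longrightarrow> (g has_derivative g' x) (at x)" "\<And>v. Ck_on k W (\<lambda>x. g' x v)"
    using Ck_on_SucE[OF Suc.prems(2)] by metis
  have gf: "((\<lambda>x. g (f x)) has_derivative (\<lambda>v. g' (f x) (f' x v))) (at x)" if "x \<in> V" for x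
  proof -
    have "f x \<in> W" using that assms(3) by auto
    then show ?thesis using has_derivative_compose[OF f'(1)[OF that] g'(1)] by simp
  qed
  have exp: "g' (f x) (f' x v) = (\<Sum>b\<in>Basis. (f' x v \<bullet> b) *\<^sub>R g' (f x) b)" if "x \<in> V" for x v
  proof -
    have "f x \<in> W" using that assms(3) by auto
    then have "linear (g' (f x))" using g'(1) has_derivative_linear by blast
    then have "(\<Sum>b\<in>Basis. (f' x v \<bullet> b) *\<^sub>R g' (f x) b) = g' (f x) (\<Sum>b\<in>Basis. (f' x v \<bullet> b) *\<^sub>R b)"
      by (simp add: linear_sum linear_scale)
    then show ?thesis by (simp add: euclidean_representation)
  qed
  have "((\<lambda>x. g (f x)) has_derivative (\<lambda>v. \<Sum>b\<in>Basis. (f' x v \<bullet> b) *\<^sub>R g' (f x) b)) (at x)"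
    if "x \<in> V" for x using gf[OF that] exp[OF that] by simp
  moreover have "Ck_on k V (\<lambda>x. \<Sum>b\<in>Basis. (f' x v \<bullet> b) *\<^sub>R g' (f x) b)" for v
    by (intro Ck_on_sum Ck_on_scaleR Ck_on_inner Ck_on_const Suc.IH g' f' Ck_on_SucD[OF Suc.prems(1)] assms(1))
  ultimately show ?case by (rule Ck_on_SucI[OF assms(1)])
qed

lemma Ck_on_inverse_real: "Ck_on k (- {0::real}) inverse"
proof (induction k)
  case 0 then show ?case by (auto intro!: continuous_intros)
next
  case (Suc k)
  have o: "open (- {0::real})" by auto
  show ?case
  proof (rule Ck_on_SucI[OF o])
    fix x :: real assume "x \<in> - {0}"
    then show "(inverse has_derivative (\<lambda>v. (- v) *\<^sub>R (inverse x * inverse x))) (at x)"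
      using has_derivative_inverse'[of x UNIV] by (simp add: mult.commute mult.left_commute)
  next
    fix v :: real
    show "Ck_on k (- {0}) (\<lambda>x::real. (- v) *\<^sub>R (inverse x * inverse x))"
      by (intro Ck_on_scaleR[OF o] Ck_on_mult[OF o] Ck_on_const[OF o] Suc)
  qed
qed

lemma Ck_on_inverse:
  fixes f :: "'a::euclidean_space \<Rightarrow> real"
  assumes "open V" "Ck_on k V f" "\<And>x. x \<in> V \<Longrightarrow> f x \<noteq> 0"
  shows "Ck_on k V (\<lambda>x. inverse (f x))"
  by (rule Ck_on_compose[where W = "- {0}" and g=inverse]) (use assms Ck_on_inverse_real in auto)

section \<open>Bump functions and extension of germs\<close>

text \<open>The functions \<open>exp (- 1 / x) / x ^ m\<close>, continued by \<open>0\<close>. They are considered for all \<open>m\<close> at once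
  because the derivative of one is a linear combination of two others.\<close>

definition flat :: "nat \<Rightarrow> real \<Rightarrow> real" where
  "flat m x = (if x > 0 then exp (- inverse x) * inverse x ^ m else 0)"

lemma flat_div_tendsto: "((\<lambda>x. flat m x / x) \<longlongrightarrow> 0) (at 0)"
proof -
  have "((\<lambda>x::real. x ^ Suc m / exp x) \<longlongrightarrow> 0) at_top" by (rule tendsto_power_div_exp_0)
  then have "((\<lambda>x::real. inverse x ^ Suc m / exp (inverse x)) \<longlongrightarrow> 0) (at_right 0)"
    by (rule filterlim_compose[OF _ filterlim_inverse_at_top_right])
  then have "((\<lambda>x. flat m x / x) \<longlongrightarrow> 0) (at_right 0)"
    by (rule Lim_transform_eventually)
      (auto simp: eventually_at_right_less flat_def exp_minus field_simps intro!: eventually_at_rightI[of 0 1])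
  moreover have "((\<lambda>x. flat m x / x) \<longlongrightarrow> 0) (at_left 0)"
    by (rule Lim_transform_eventually[OF tendsto_const])
      (auto simp: flat_def intro!: eventually_at_leftI[of "-1"])
  ultimately show ?thesis by (simp add: filterlim_split_at_real)
qed

lemma flat_has_derivative:
  "(flat m has_real_derivative (flat (m + 2) x - real m * flat (m + 1) x)) (at x)"
proof -
  consider "x > 0" | "x < 0" | "x = 0" by linarith
  then show ?thesis
  proof cases
    case 1
    have "((\<lambda>x. exp (- inverse x) * inverse x ^ m) has_real_derivative
        (flat (m + 2) x - real m * flat (m + 1) x)) (at x)"
    proof -
      have "((\<lambda>x. inverse x ^ m) has_real_derivative (- real m * inverse x ^ (m + 1))) (at x)"
      proof (cases m)
        case (Suc n)
        then show ?thesis using DERIV_power_Suc[OF DERIV_inverse[of x], of n] 1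
          by (simp add: algebra_simps)
      qed simp
      moreover have "((\<lambda>x. exp (- inverse x)) has_real_derivative (exp (- inverse x) * inverse x ^ 2)) (at x)"
        using 1 by (auto intro!: derivative_eq_intros simp: field_simps power2_eq_square)
      ultimately show ?thesis using 1
        by (auto intro!: DERIV_cong[OF DERIV_mult] simp: flat_def algebra_simps power2_eq_square)
    qed
    then show ?thesis
      by (rule DERIV_cong_ev[THEN iffD1, rotated -1])
        (auto simp: flat_def eventually_nhds 1 intro!: exI[of _ "{0<..}"])
  next
    case 2
    have "((\<lambda>x. 0) has_real_derivative (flat (m + 2) x - real m * flat (m + 1) x)) (at x)"
      using 2 by (simp add: flat_def)
    then show ?thesis
      by (rule DERIV_cong_ev[THEN iffD1, rotated -1])
        (auto simp: flat_def eventually_nhds 2 intro!: exI[of _ "{..<0}"])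
  next
    case 3
    then show ?thesis
      using flat_div_tendsto by (simp add: has_field_derivative_iff) (simp add: flat_def)
  qed
qed

lemma Ck_on_flat: "Ck_on k UNIV (flat m)"
proof (induction k arbitrary: m)
  case 0 then show ?case
    using flat_has_derivative by (auto intro!: continuous_at_imp_continuous_on DERIV_isCont)
next
  case (Suc k)
  have "(flat m has_derivative (\<lambda>v. v *\<^sub>R (flat (m + 2) x + (- real m) *\<^sub>R flat (m + 1) x))) (at x)" for x
    using flat_has_derivative[of m x] by (simp add: has_field_derivative_def mult.commute[of _ "_ - _"])
  moreover have "Ck_on k UNIV (\<lambda>x. v *\<^sub>R (flat (m + 2) x + (- real m) *\<^sub>R flat (m + 1) x))" for v
    by (intro Ck_on_add Ck_on_scaleR Ck_on_const Suc open_UNIV)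
  ultimately show ?case by (intro Ck_on_SucI) auto
qed

lemma flat_0_sign: "flat 0 x > 0 \<longleftrightarrow> x > 0" "flat 0 x \<ge> 0" "x \<le> 0 \<Longrightarrow> flat 0 x = 0"
  by (auto simp: flat_def)

lemma bump_exists:
  fixes x :: "'a::euclidean_space"
  assumes "open V" "x \<in> V"
  obtains \<phi> :: "'a \<Rightarrow> real" and U W where "Cinf_on UNIV \<phi>" "open U" "U \<union> V = UNIV" "\<And>y. y \<in> U \<Longrightarrow> \<phi> y = 0"
    "open W" "x \<in> W" "W \<subseteq> V" "\<And>y. y \<in> W \<Longrightarrow> \<phi> y = 1"
proof -
  obtain r where r: "r > 0" "ball x r \<subseteq> V" using assms openE by blast
  define q where "q y = (y - x) \<bullet> (y - x)" for y
  have q: "q y = (dist x y)\<^sup>2" for y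
    by (simp add: q_def dist_commute[of x y]) (simp add: dist_norm power2_norm_eq_inner)
  \<comment> \<open>\<open>\<phi>\<close> equals 1 where \<open>q \<le> r\<^sup>2 / 9\<close> and 0 where \<open>q \<ge> 4 r\<^sup>2 / 9\<close>.\<close>
  define d where "d y = flat 0 (4 * r\<^sup>2 / 9 - q y) + flat 0 (q y - r\<^sup>2 / 9)" for y
  have r2: "r\<^sup>2 > 0" using r by simp
  have d0: "d y > 0" for y
  proof -
    have "4 * r\<^sup>2 / 9 - q y > 0 \<or> q y - r\<^sup>2 / 9 > 0" using r2 by linarith
    then show ?thesis unfolding d_def using flat_0_sign(1,2) by (metis add_pos_nonneg add_nonneg_pos)
  qed
  define \<phi> where "\<phi> y = flat 0 (4 * r\<^sup>2 / 9 - q y) * inverse (d y)" for y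
  have Cq: "Ck_on k UNIV (\<lambda>y. flat 0 (\<alpha> * q y + c))" for k \<alpha> c
  proof (rule Ck_on_compose[OF open_UNIV open_UNIV, of _ _ "flat 0"])
    have "Ck_on k UNIV (\<lambda>y. y + (- x))"
      by (intro Ck_on_add Ck_on_const Ck_on_linear open_UNIV bounded_linear_ident)
    then show "Ck_on k UNIV (\<lambda>y. \<alpha> * q y + c)" unfolding q_def
      by (intro Ck_on_add Ck_on_mult Ck_on_inner Ck_on_const) auto
  qed (auto intro: Ck_on_flat)
  show ?thesis
  proof
    show "Cinf_on UNIV \<phi>"
    proof
      fix k
      have 1: "Ck_on k UNIV (\<lambda>y. flat 0 (4 * r\<^sup>2 / 9 - q y))" using Cq[of k "-1" "4 * r\<^sup>2 / 9"] by simp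
      moreover have 2: "Ck_on k UNIV (\<lambda>y. flat 0 (q y - r\<^sup>2 / 9))" using Cq[of k 1 "- r\<^sup>2 / 9"] by simp
      ultimately show "Ck_on k UNIV \<phi>" unfolding \<phi>_def using d0 unfolding d_def
        by (intro Ck_on_mult Ck_on_inverse Ck_on_add) (auto simp: less_imp_neq[symmetric])
    qed
    show "open (- cball x (2 * r / 3))" by auto
    show "- cball x (2 * r / 3) \<union> V = UNIV" using r by force
    show "open (ball x (r / 3))" "x \<in> ball x (r / 3)" "ball x (r / 3) \<subseteq> V" using r by force+
    fix y
    show "\<phi> y = 0" if "y \<in> - cball x (2 * r / 3)"
    proof -
      have "2 * r / 3 < dist x y" using that by auto
      then have "(2 * r / 3)\<^sup>2 \<le> q y" unfolding q using r(1) by (intro power_mono) auto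
      then show ?thesis by (simp add: \<phi>_def flat_0_sign power_divide)
    qed
    show "\<phi> y = 1" if "y \<in> ball x (r / 3)"
    proof -
      have "dist x y < r / 3" using that by auto
      then have "q y \<le> (r / 3)\<^sup>2" unfolding q by (intro power_mono) auto
      then have "q y - r\<^sup>2 / 9 \<le> 0" by (simp add: power_divide)
      then have "d y = flat 0 (4 * r\<^sup>2 / 9 - q y)" by (simp add: d_def flat_0_sign)
      with d0[of y] show ?thesis by (simp add: \<phi>_def)
    qed
  qed
qed

text \<open>Every germ has a global representative. This is what makes brackets of functions that are only
  defined on part of the manifold meaningful.\<close>

lemma Cinf_extend:
  fixes x :: "'a::euclidean_space" and G :: "'a \<Rightarrow> 'b::real_normed_vector"
  assumes "open V" "x \<in> V" "Cinf_on V G"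
  obtains g W where "Cinf_on UNIV g" "open W" "x \<in> W" "W \<subseteq> V" "\<And>y. y \<in> W \<Longrightarrow> g y = G y"
proof -
  obtain \<phi> :: "'a \<Rightarrow> real" and U W where \<phi>: "Cinf_on UNIV \<phi>" "open U" "U \<union> V = UNIV"
    "\<And>y. y \<in> U \<Longrightarrow> \<phi> y = 0" "open W" "x \<in> W" "W \<subseteq> V" "\<And>y. y \<in> W \<Longrightarrow> \<phi> y = 1"
    using bump_exists[OF assms(1,2)] by metis
  define g where "g y = (if y \<in> V then \<phi> y *\<^sub>R G y else 0)" for y
  have "Ck_on k V g" for k
  proof -
    have "Ck_on k V (\<lambda>y. \<phi> y *\<^sub>R G y)"
      using \<phi>(1) assms by (intro Ck_on_scaleR) (auto intro: Ck_on_subset)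
    then show ?thesis
      using Ck_on_cong[OF assms(1), of g "\<lambda>y. \<phi> y *\<^sub>R G y" k] by (auto simp: g_def)
  qed
  moreover have "Ck_on k U g" for k
    using Ck_on_cong[OF \<phi>(2), of g "\<lambda>y. 0" k] Ck_on_const[OF \<phi>(2), of k 0] \<phi>(4)
    by (auto simp: g_def)
  ultimately have "Cinf_on UNIV g" using Ck_on_Un[OF \<phi>(2) assms(1)] \<phi>(3) by metis
  then show ?thesis using that[of g W] \<phi>(5-8) by (simp add: g_def subset_eq)
qed

section \<open>Hadamard's lemma\<close>

lemma radial_in_ball:
  fixes x :: "'a::real_normed_vector"
  shows "y \<in> ball x r \<Longrightarrow> s \<in> {0..1} \<Longrightarrow> x + s *\<^sub>R (y - x) \<in> ball x r"
proof -
  assume y: "y \<in> ball x r" and s: "s \<in> {0..1::real}"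
  have "norm (s *\<^sub>R (y - x)) \<le> norm (y - x)" using s by (simp add: mult_left_le_one_le)
  then show ?thesis using y by (simp add: dist_norm norm_minus_commute)
qed

text \<open>Differentiating under the integral sign multiplies the integrand by \<open>s\<close> (the inner derivative) and
  replaces \<open>F\<close> by a directional derivative. The weight \<open>s ^ m\<close> makes the family of integrals stable
  under this, so that induction on the order of differentiability applies.\<close>

lemma Ck_on_radial_integral:
  fixes F :: "'a::euclidean_space \<Rightarrow> 'b::banach"
  assumes V: "V = ball x r"
  shows "Cinf_on V F \<Longrightarrow> Ck_on k V (\<lambda>y. integral {0..1} (\<lambda>s. s ^ m *\<^sub>R F (x + s *\<^sub>R (y - x))))"
proof (induction k arbitrary: F m)
  case 0
  have "continuous_on V F" using 0 by (metis Ck_on.simps(1))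
  then have "continuous_on (V \<times> cbox 0 1) (\<lambda>(y, s::real). s ^ m *\<^sub>R F (x + s *\<^sub>R (y - x)))"
    unfolding split_beta
    by (auto intro!: continuous_intros elim!: continuous_on_compose2 simp: V simp del: mem_ball
        intro: radial_in_ball)
  then have "continuous_on V (\<lambda>y. integral (cbox 0 1) (\<lambda>s. s ^ m *\<^sub>R F (x + s *\<^sub>R (y - x))))"
    by (rule integral_continuous_on_param)
  then show ?case by simp
next
  case (Suc k)
  have oV: "open V" "convex V" by (auto simp: V)
  obtain F' where F': "\<And>x. x \<in> V \<Longrightarrow> (F has_derivative F' x) (at x)"
    and F'C: "\<And>v. Cinf_on V (\<lambda>x. F' x v)"
  proof
    show "(F has_derivative frechet_derivative F (at x)) (at x)" if "x \<in> V" for x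
      using Suc.prems that by (metis Ck_on.simps(2) frechet_derivative_works)
    show "Cinf_on V (\<lambda>x. frechet_derivative F (at x) v)" for v
      using Suc.prems by (metis Ck_on.simps(2))
  qed
  have contF: "continuous_on V F" using Suc.prems by (metis Ck_on.simps(1))
  have contF': "continuous_on V (\<lambda>x. F' x v)" for v using F'C by (metis Ck_on.simps(1))
  have cont: "continuous_on (V \<times> cbox 0 1) (\<lambda>z. G (x + snd z *\<^sub>R (fst z - x)))"
    if "continuous_on V G" for G :: "'a \<Rightarrow> 'b"
    by (rule continuous_on_compose2[OF that])
      (auto intro!: continuous_intros simp: V simp del: mem_ball intro: radial_in_ball)
  define B where "B y s = Blinfun (\<lambda>v. s ^ Suc m *\<^sub>R F' (x + s *\<^sub>R (y - x)) v)" for y s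
  have B: "blinfun_apply (B y s) v = s ^ Suc m *\<^sub>R F' (x + s *\<^sub>R (y - x)) v"
    if "y \<in> V" "s \<in> cbox 0 1" for y s v
  proof -
    have "x + s *\<^sub>R (y - x) \<in> V" using radial_in_ball that by (simp add: V)
    then have "bounded_linear (F' (x + s *\<^sub>R (y - x)))" using F' has_derivative_bounded_linear by blast
    then show ?thesis unfolding B_def
      by (subst bounded_linear_Blinfun_apply) (auto intro: bounded_linear_intros)
  qed
  have deriv: "((\<lambda>y. integral (cbox 0 1) (\<lambda>s. s ^ m *\<^sub>R F (x + s *\<^sub>R (y - x)))) has_derivative
      integral (cbox 0 1) (B y)) (at y within V)" if y: "y \<in> V" for y
  proof (rule leibniz_rule[OF _ _ _ y \<open>convex V\<close>])
    fix y and s :: real assume y: "y \<in> V" and s: "s \<in> cbox 0 1"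
    have "x + s *\<^sub>R (y - x) \<in> V" using radial_in_ball y s by (simp add: V)
    note F'' = has_derivative_compose[where f="\<lambda>y. x + s *\<^sub>R (y - x)" and f'="\<lambda>v. s *\<^sub>R v" and g=F,
        OF _ F'[OF this]]
    have "((\<lambda>y. s ^ m *\<^sub>R F (x + s *\<^sub>R (y - x))) has_derivative
        (\<lambda>v. s ^ m *\<^sub>R F' (x + s *\<^sub>R (y - x)) (s *\<^sub>R v))) (at y within V)"
      by (intro has_derivative_scaleR_right F'') (auto intro!: derivative_eq_intros)
    moreover have "blinfun_apply (B y s) = (\<lambda>v. s ^ m *\<^sub>R F' (x + s *\<^sub>R (y - x)) (s *\<^sub>R v))"
      using has_derivative_linear[OF F'[OF \<open>x + s *\<^sub>R (y - x) \<in> V\<close>]]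
      by (auto simp: B[OF y s] linear_scale mult.commute)
    ultimately show "((\<lambda>y. s ^ m *\<^sub>R F (x + s *\<^sub>R (y - x))) has_derivative blinfun_apply (B y s)) (at y within V)"
      by simp
  next
    fix y assume y: "y \<in> V"
    have "continuous_on (cbox 0 1) (\<lambda>s. s ^ m *\<^sub>R F (x + s *\<^sub>R (y - x)))"
      by (intro continuous_intros continuous_on_compose2[OF contF])
        (use y in \<open>auto simp: V simp del: mem_ball intro: radial_in_ball\<close>)
    then show "(\<lambda>s. s ^ m *\<^sub>R F (x + s *\<^sub>R (y - x))) integrable_on cbox 0 1"
      by (rule integrable_continuous)
  next
    show "continuous_on (V \<times> cbox 0 1) (\<lambda>(y, s). B y s)"
      unfolding split_beta
    proof (rule continuous_on_blinfun_componentwise)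
      fix i :: 'a
      have "continuous_on (V \<times> cbox 0 1) (\<lambda>z. snd z ^ Suc m *\<^sub>R F' (x + snd z *\<^sub>R (fst z - x)) i)"
        by (intro continuous_intros cont[OF contF'])
      then show "continuous_on (V \<times> cbox 0 1) (\<lambda>z. blinfun_apply (B (fst z) (snd z)) i)"
        by (rule continuous_on_eq) (auto simp: B)
    qed
  qed
  have Bint: "blinfun_apply (integral (cbox 0 1) (B y)) v
      = integral {0..1} (\<lambda>s. s ^ Suc m *\<^sub>R F' (x + s *\<^sub>R (y - x)) v)" if y: "y \<in> V" for y v
  proof -
    have "continuous_on (cbox 0 1) (B y)"
    proof (rule continuous_on_blinfun_componentwise)
      fix i :: 'a
      have "continuous_on (cbox 0 1) (\<lambda>s. s ^ Suc m *\<^sub>R F' (x + s *\<^sub>R (y - x)) i)"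
        by (intro continuous_intros continuous_on_compose2[OF contF'])
          (use y in \<open>auto simp: V simp del: mem_ball intro: radial_in_ball\<close>)
      then show "continuous_on (cbox 0 1) (\<lambda>s. blinfun_apply (B y s) i)"
        by (rule continuous_on_eq) (use y in \<open>auto simp: B\<close>)
    qed
    then have "B y integrable_on cbox 0 1" by (rule integrable_continuous)
    then have "blinfun_apply (integral (cbox 0 1) (B y)) v = integral (cbox 0 1) (\<lambda>s. blinfun_apply (B y s) v)"
      by (rule blinfun_apply_integral)
    also have "\<dots> = integral (cbox 0 1) (\<lambda>s. s ^ Suc m *\<^sub>R F' (x + s *\<^sub>R (y - x)) v)"
      by (rule integral_cong) (use y in \<open>auto simp: B\<close>)
    finally show ?thesis by simp
  qed
  show ?case
  proof (rule Ck_on_SucI[OF oV(1)])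
    show "((\<lambda>y. integral {0..1} (\<lambda>s. s ^ m *\<^sub>R F (x + s *\<^sub>R (y - x)))) has_derivative
        (\<lambda>v. integral {0..1} (\<lambda>s. s ^ Suc m *\<^sub>R F' (x + s *\<^sub>R (y - x)) v))) (at y)" if "y \<in> V" for y
      using deriv[OF that] Bint[OF that] at_within_open[OF that oV(1)]
      by (metis (no_types, lifting) box_real(2) ext)
    show "Ck_on k V (\<lambda>y. integral {0..1} (\<lambda>s. s ^ Suc m *\<^sub>R F' (x + s *\<^sub>R (y - x)) v))" for v
      by (rule Suc.IH[OF F'C])
  qed
qed

text \<open>Integrate the derivative of \<open>H\<close> along the segment from \<open>x\<close> to \<open>y\<close>.\<close>

lemma hadamard:
  fixes H :: "'a::euclidean_space \<Rightarrow> 'b::banach"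
  assumes "Cinf_on (ball x r) H" "r > 0"
  obtains G where "\<And>b. Cinf_on (ball x r) (G b)" "\<And>b. G b x = frechet_derivative H (at x) b"
    "\<And>y. y \<in> ball x r \<Longrightarrow> H y = H x + (\<Sum>b\<in>Basis. ((y - x) \<bullet> b) *\<^sub>R G b y)"
proof -
  let ?V = "ball x r"
  define H' where "H' y = frechet_derivative H (at y)" for y
  have H': "(H has_derivative H' y) (at y)" if "y \<in> ?V" for y
    using assms that unfolding H'_def by (metis Ck_on.simps(2) frechet_derivative_works)
  have H'C: "Cinf_on ?V (\<lambda>y. H' y v)" for v using assms unfolding H'_def by (metis Ck_on.simps(2))
  define G where "G b y = integral {0..1} (\<lambda>s. s ^ 0 *\<^sub>R H' (x + s *\<^sub>R (y - x)) b)" for b y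
  show ?thesis
  proof
    show "Cinf_on ?V (G b)" for b unfolding G_def using Ck_on_radial_integral[OF refl H'C] by blast
    show "G b x = frechet_derivative H (at x) b" for b by (simp add: G_def H'_def)
    fix y assume y: "y \<in> ?V"
    have in_V: "x + s *\<^sub>R (y - x) \<in> ?V" if "s \<in> {0..1}" for s using radial_in_ball y that by blast
    have int: "((\<lambda>s. H' (x + s *\<^sub>R (y - x)) (y - x)) has_integral (H (x + 1 *\<^sub>R (y - x)) - H (x + 0 *\<^sub>R (y - x)))) {0..1}"
    proof (rule fundamental_theorem_of_calculus)
      fix s :: real assume s: "s \<in> {0..1}"
      have "((\<lambda>s. x + s *\<^sub>R (y - x)) has_derivative (\<lambda>h. h *\<^sub>R (y - x))) (at s within {0..1})"
        by (auto intro!: derivative_eq_intros)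
      from has_derivative_compose[OF this H'[OF in_V[OF s]]]
      show "((\<lambda>s. H (x + s *\<^sub>R (y - x))) has_vector_derivative H' (x + s *\<^sub>R (y - x)) (y - x)) (at s within {0..1})"
        using has_derivative_linear[OF H'[OF in_V[OF s]]]
        by (simp add: has_vector_derivative_def linear_scale)
    qed simp
    have lin: "H' (x + s *\<^sub>R (y - x)) (y - x) = (\<Sum>b\<in>Basis. ((y - x) \<bullet> b) *\<^sub>R H' (x + s *\<^sub>R (y - x)) b)"
      if "s \<in> {0..1}" for s
    proof -
      have l: "linear (H' (x + s *\<^sub>R (y - x)))" using has_derivative_linear[OF H'[OF in_V[OF that]]] .
      have "H' (x + s *\<^sub>R (y - x)) (\<Sum>b\<in>Basis. ((y - x) \<bullet> b) *\<^sub>R b)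
        = (\<Sum>b\<in>Basis. ((y - x) \<bullet> b) *\<^sub>R H' (x + s *\<^sub>R (y - x)) b)"
        by (simp add: linear_sum[OF l] linear_scale[OF l])
      then show ?thesis by (simp only: euclidean_representation)
    qed
    have integrable: "(\<lambda>s. H' (x + s *\<^sub>R (y - x)) b) integrable_on {0..1}" for b
    proof (rule integrable_continuous_interval)
      have "continuous_on ?V (\<lambda>z. H' z b)" using H'C by (metis Ck_on.simps(1))
      then show "continuous_on {0..1} (\<lambda>s. H' (x + s *\<^sub>R (y - x)) b)"
        by (rule continuous_on_compose2) (use in_V in \<open>auto intro!: continuous_intros\<close>)
    qed
    have "H y - H x = integral {0..1} (\<lambda>s. H' (x + s *\<^sub>R (y - x)) (y - x))"
      using integral_unique[OF int] by simp
    also have "\<dots> = integral {0..1} (\<lambda>s. \<Sum>b\<in>Basis. ((y - x) \<bullet> b) *\<^sub>R H' (x + s *\<^sub>R (y - x)) b)"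
      by (rule integral_cong) (rule lin)
    also have "\<dots> = (\<Sum>b\<in>Basis. ((y - x) \<bullet> b) *\<^sub>R G b y)"
      by (subst integral_sum) (auto intro: integrable_cmul integrable simp: G_def)
    finally show "H y = H x + (\<Sum>b\<in>Basis. ((y - x) \<bullet> b) *\<^sub>R G b y)" by (simp add: algebra_simps)
  qed
qed

section \<open>Smooth functions on a subset\<close>

lemma smooth_onI_open:
  assumes "open V" "M \<subseteq> V" "Cinf_on V f"
  shows "smooth_on M f"
  unfolding smooth_on_def
proof
  fix x assume "x \<in> M"
  with assms(2) have "x \<in> V" by blast
  with assms(1,3) show "\<exists>V F. open V \<and> x \<in> V \<and> Cinf_on V F \<and> (\<forall>y\<in>M \<inter> V. F y = f y)"
    by (intro exI[of _ V] exI[of _ f] conjI ballI refl)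
qed

lemma smooth_onE:
  assumes "smooth_on M f" "x \<in> M"
  obtains V F where "open V" "x \<in> V" "Cinf_on V F" "\<And>y. y \<in> M \<Longrightarrow> y \<in> V \<Longrightarrow> F y = f y"
proof -
  from assms obtain V F where "open V \<and> x \<in> V \<and> Cinf_on V F \<and> (\<forall>y\<in>M \<inter> V. F y = f y)"
    unfolding smooth_on_def by blast
  then show ?thesis using that[of V F] by simp
qed

lemma smooth_on_cong:
  assumes "\<And>x. x \<in> M \<Longrightarrow> f x = g x"
  shows "smooth_on M f \<longleftrightarrow> smooth_on M g"
proof -
  have "(\<forall>y\<in>M \<inter> V. F y = f y) \<longleftrightarrow> (\<forall>y\<in>M \<inter> V. F y = g y)" for V F
    using assms by auto
  then show ?thesis by (simp add: smooth_on_def)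
qed

lemma smooth_on_bilinear:
  assumes "bounded_bilinear T" "smooth_on M f" "smooth_on M g"
  shows "smooth_on M (\<lambda>x. T (f x) (g x))"
  unfolding smooth_on_def
proof
  fix x assume "x \<in> M"
  obtain V F where VF: "open V" "x \<in> V" "Cinf_on V F" "\<And>y. y \<in> M \<Longrightarrow> y \<in> V \<Longrightarrow> F y = f y"
    by (rule smooth_onE[OF assms(2) \<open>x \<in> M\<close>]) blast
  obtain W G where WG: "open W" "x \<in> W" "Cinf_on W G" "\<And>y. y \<in> M \<Longrightarrow> y \<in> W \<Longrightarrow> G y = g y"
    by (rule smooth_onE[OF assms(3) \<open>x \<in> M\<close>]) blast
  have "Ck_on k (V \<inter> W) (\<lambda>x. T (F x) (G x))" for k
    by (rule Ck_on_bilinear[OF open_Int[OF VF(1) WG(1)] assms(1)]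
        Ck_on_subset[OF spec[OF VF(3)] Int_lower1] Ck_on_subset[OF spec[OF WG(3)] Int_lower2])+
  then show "\<exists>V F. open V \<and> x \<in> V \<and> Cinf_on V F \<and> (\<forall>y\<in>M \<inter> V. F y = T (f y) (g y))"
    using VF WG by (intro exI[of _ "V \<inter> W"] exI[of _ "\<lambda>x. T (F x) (G x)"]) auto
qed

lemma smooth_on_add:
  assumes "smooth_on M f" "smooth_on M g"
  shows "smooth_on M (\<lambda>x. f x + g x)"
  unfolding smooth_on_def
proof
  fix x assume "x \<in> M"
  obtain V F where VF: "open V" "x \<in> V" "Cinf_on V F" "\<And>y. y \<in> M \<Longrightarrow> y \<in> V \<Longrightarrow> F y = f y"
    by (rule smooth_onE[OF assms(1) \<open>x \<in> M\<close>]) blast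
  obtain W G where WG: "open W" "x \<in> W" "Cinf_on W G" "\<And>y. y \<in> M \<Longrightarrow> y \<in> W \<Longrightarrow> G y = g y"
    by (rule smooth_onE[OF assms(2) \<open>x \<in> M\<close>]) blast
  have "Ck_on k (V \<inter> W) (\<lambda>x. F x + G x)" for k
    by (rule Ck_on_add[OF open_Int[OF VF(1) WG(1)]]
        Ck_on_subset[OF spec[OF VF(3)] Int_lower1] Ck_on_subset[OF spec[OF WG(3)] Int_lower2])+
  then show "\<exists>V F. open V \<and> x \<in> V \<and> Cinf_on V F \<and> (\<forall>y\<in>M \<inter> V. F y = f y + g y)"
    using VF WG by (intro exI[of _ "V \<inter> W"] exI[of _ "\<lambda>x. F x + G x"]) auto
qed

lemma smooth_on_bounded_linear_compose:
  assumes "bounded_linear T" "smooth_on M f"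
  shows "smooth_on M (\<lambda>x. T (f x))"
  unfolding smooth_on_def
proof
  fix x assume "x \<in> M"
  obtain V F where VF: "open V" "x \<in> V" "Cinf_on V F" "\<And>y. y \<in> M \<Longrightarrow> y \<in> V \<Longrightarrow> F y = f y"
    by (rule smooth_onE[OF assms(2) \<open>x \<in> M\<close>]) blast
  have "Cinf_on V (\<lambda>x. T (F x))" by (rule allI, rule Ck_on_bounded_linear[OF VF(1) assms(1) spec[OF VF(3)]])
  then show "\<exists>V F. open V \<and> x \<in> V \<and> Cinf_on V F \<and> (\<forall>y\<in>M \<inter> V. F y = T (f y))"
    using VF by (intro exI[of _ V] exI[of _ "\<lambda>x. T (F x)"]) auto
qed

lemma smooth_on_const: "smooth_on M (\<lambda>x. c)"
  by (rule smooth_onI_open[OF open_UNIV subset_UNIV]) (rule allI Ck_on_const open_UNIV)+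

lemma smooth_on_linear: "bounded_linear T \<Longrightarrow> smooth_on M T"
  by (rule smooth_onI_open[OF open_UNIV subset_UNIV]) (simp add: Ck_on_linear)

lemma smooth_on_imp_continuous_on:
  assumes "smooth_on M f" shows "continuous_on M f"
  unfolding continuous_on_eq_continuous_within
proof
  fix x assume "x \<in> M"
  obtain V F where VF: "open V" "x \<in> V" "Cinf_on V F" "\<And>y. y \<in> M \<Longrightarrow> y \<in> V \<Longrightarrow> F y = f y"
    by (rule smooth_onE[OF assms \<open>x \<in> M\<close>]) blast
  have "continuous_on V F" using VF(3) by (metis Ck_on.simps(1))
  then have "continuous (at x within M) F"
    using VF(1,2) by (metis continuous_on_eq_continuous_at continuous_at_imp_continuous_at_within)
  moreover have "eventually (\<lambda>y. F y = f y) (at x within M)"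
    using VF by (auto simp: eventually_at_topological)
  ultimately show "continuous (at x within M) f"
    using VF \<open>x \<in> M\<close> by (simp add: continuous_within tendsto_cong)
qed

lemma Cinf_on_imp_smooth_on: "Cinf_on UNIV f \<Longrightarrow> smooth_on M f"
  by (rule smooth_onI_open[OF open_UNIV subset_UNIV])

lemma smooth_on_cmult: "smooth_on M f \<Longrightarrow> smooth_on M (\<lambda>x. c * f x)" for f :: "_ \<Rightarrow> complex"
  by (rule smooth_on_bounded_linear_compose[OF bounded_linear_mult_right])

lemma smooth_on_cnj: "smooth_on M f \<Longrightarrow> smooth_on M (\<lambda>x. cnj (f x))"
  by (rule smooth_on_bounded_linear_compose[OF bounded_linear_cnj])

lemma smooth_on_mult:
  "smooth_on M f \<Longrightarrow> smooth_on M g \<Longrightarrow> smooth_on M (\<lambda>x. f x * g x)" for f :: "_ \<Rightarrow> complex"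
  by (rule smooth_on_bilinear[OF bounded_bilinear_mult])

lemma smooth_on_sum:
  "(\<And>i. i \<in> I \<Longrightarrow> smooth_on M (f i)) \<Longrightarrow> smooth_on M (\<lambda>x. \<Sum>i\<in>I. f i x)"
  by (induction I rule: infinite_finite_induct) (simp_all add: smooth_on_add smooth_on_const)

abbreviation cartesian :: "'a::euclidean_space \<Rightarrow> 'a \<Rightarrow> complex" where
  "cartesian u \<equiv> \<lambda>y. complex_of_real (y \<bullet> u)"

lemma bounded_linear_cartesian: "bounded_linear (cartesian u)"
  using bounded_linear_compose[OF bounded_linear_of_real bounded_linear_inner_left[of u]] by simp

lemma smooth_on_cartesian: "smooth_on M (cartesian u)"
  by (rule smooth_on_linear[OF bounded_linear_cartesian])

lemmas smooth_intros = smooth_on_add smooth_on_const smooth_on_cmult smooth_on_cnj smooth_on_mult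
  smooth_on_sum smooth_on_cartesian

section \<open>Poisson brackets are local biderivations\<close>

locale poisson_manifold =
  fixes M :: "'a::euclidean_space set"
    and br :: "('a \<Rightarrow> complex) \<Rightarrow> ('a \<Rightarrow> complex) \<Rightarrow> 'a \<Rightarrow> complex"
  assumes poisson: "poisson_bracket_on M br"
begin

abbreviation S :: "('a \<Rightarrow> complex) \<Rightarrow> bool" where "S \<equiv> smooth_on M"

lemma br_smooth: "S f \<Longrightarrow> S g \<Longrightarrow> S (br f g)"
  by (rule poisson[unfolded poisson_bracket_on_def, THEN conjunct1, rule_format])

lemma br_cong: "S f \<Longrightarrow> S g \<Longrightarrow> (\<And>x. x \<in> M \<Longrightarrow> f x = f' x) \<Longrightarrow> (\<And>x. x \<in> M \<Longrightarrow> g x = g' x) \<Longrightarrow>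
    x \<in> M \<Longrightarrow> br f g x = br f' g' x"
  by (rule poisson[unfolded poisson_bracket_on_def, THEN conjunct2, THEN conjunct1, rule_format])

lemma br_antisym: "S f \<Longrightarrow> S g \<Longrightarrow> x \<in> M \<Longrightarrow> br f g x = - br g f x"
  by (rule poisson[unfolded poisson_bracket_on_def, THEN conjunct2, THEN conjunct2, THEN conjunct2, THEN conjunct1, rule_format])

lemma br_cnj: "S f \<Longrightarrow> S g \<Longrightarrow> x \<in> M \<Longrightarrow>
    br (\<lambda>y. cnj (f y)) (\<lambda>y. cnj (g y)) x = - cnj (br f g x)"
  by (rule poisson[unfolded poisson_bracket_on_def, THEN conjunct2, THEN conjunct2, THEN conjunct2, THEN conjunct2, THEN conjunct2, THEN conjunct2, rule_format])

lemma br_lin: "S f \<Longrightarrow> S g \<Longrightarrow> S h \<Longrightarrow> x \<in> M \<Longrightarrow>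
    br (\<lambda>y. c * f y + g y) h x = c * br f h x + br g h x"
  by (rule poisson[unfolded poisson_bracket_on_def, THEN conjunct2, THEN conjunct2, THEN conjunct1, rule_format])

lemma br_mult: "S f \<Longrightarrow> S g \<Longrightarrow> S h \<Longrightarrow> x \<in> M \<Longrightarrow>
    br (\<lambda>y. f y * g y) h x = f x * br g h x + br f h x * g x"
  by (rule poisson[unfolded poisson_bracket_on_def, THEN conjunct2, THEN conjunct2, THEN conjunct2, THEN conjunct2, THEN conjunct1, rule_format])

lemma br_add: "S f \<Longrightarrow> S g \<Longrightarrow> S h \<Longrightarrow> x \<in> M \<Longrightarrow> br (\<lambda>y. f y + g y) h x = br f h x + br g h x"
  using br_lin[of f g h x 1] by simp

lemma br_zero: "S h \<Longrightarrow> x \<in> M \<Longrightarrow> br (\<lambda>y. 0) h x = 0"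
  using br_add[of "\<lambda>y. 0" "\<lambda>y. 0" h x] by (simp add: smooth_on_const)

lemma br_cmult: "S f \<Longrightarrow> S h \<Longrightarrow> x \<in> M \<Longrightarrow> br (\<lambda>y. c * f y) h x = c * br f h x"
  using br_lin[of f "\<lambda>y. 0" h x c] by (simp add: br_zero smooth_on_const)

lemma br_const:
  assumes "S h" "x \<in> M" shows "br (\<lambda>y. c) h x = 0"
proof -
  have "br (\<lambda>y. 1) h x = 0" using br_mult[of "\<lambda>y. 1" "\<lambda>y. 1" h x] assms by (simp add: smooth_on_const)
  then show ?thesis using br_cmult[of "\<lambda>y. 1" h x c] assms by (simp add: smooth_on_const)
qed

lemma br_sum: "(\<And>i. i \<in> I \<Longrightarrow> S (f i)) \<Longrightarrow> S h \<Longrightarrow> x \<in> M \<Longrightarrow>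
    br (\<lambda>y. \<Sum>i\<in>I. f i y) h x = (\<Sum>i\<in>I. br (f i) h x)"
proof (induction I rule: infinite_finite_induct)
  case (infinite I)
  then show ?case by (simp add: br_zero)
next
  case empty
  then show ?case by (simp add: br_zero)
next
  case (insert i I)
  then show ?case using br_add[of "f i" "\<lambda>y. \<Sum>i\<in>I. f i y" h x] by (simp add: smooth_on_sum)
qed

lemma br_add_right:
  assumes "S f" "S g" "S h" "x \<in> M"
  shows "br h (\<lambda>y. f y + g y) x = br h f x + br h g x"
  unfolding br_antisym[OF assms(3) smooth_on_add[OF assms(1,2)] assms(4)] br_add[OF assms]
    br_antisym[OF assms(3,1,4)] br_antisym[OF assms(3,2,4)] by simp

lemma br_cmult_right:
  assumes "S f" "S h" "x \<in> M"
  shows "br h (\<lambda>y. c * f y) x = c * br h f x"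
  unfolding br_antisym[OF assms(2) smooth_on_cmult[OF assms(1)] assms(3)] br_cmult[OF assms]
    br_antisym[OF assms(2,1,3)] by simp

lemma br_mult_right:
  assumes "S f" "S g" "S h" "x \<in> M"
  shows "br h (\<lambda>y. f y * g y) x = f x * br h g x + br h f x * g x"
  unfolding br_antisym[OF assms(3) smooth_on_mult[OF assms(1,2)] assms(4)] br_mult[OF assms]
    br_antisym[OF assms(3,1,4)] br_antisym[OF assms(3,2,4)] by simp

text \<open>If \<open>u = f - g\<close> vanishes near \<open>x\<close> and \<open>\<psi>\<close> is a bump function with \<open>\<psi> x = 1\<close> and support in that
  neighbourhood, then \<open>\<psi> u = 0\<close>, and the Leibniz rule for this product at \<open>x\<close> gives \<open>{u, h} = 0\<close>.\<close>

lemma br_local: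
  assumes "S f" "S g" "S h" "x \<in> M" "open V" "x \<in> V" "\<And>y. y \<in> M \<Longrightarrow> y \<in> V \<Longrightarrow> f y = g y"
  shows "br f h x = br g h x"
proof -
  obtain \<phi> :: "'a \<Rightarrow> real" and U W where \<phi>: "Cinf_on UNIV \<phi>" "open U" "U \<union> V = UNIV"
    "\<And>y. y \<in> U \<Longrightarrow> \<phi> y = 0" "open W" "x \<in> W" "W \<subseteq> V" "\<And>y. y \<in> W \<Longrightarrow> \<phi> y = 1"
    by (rule bump_exists[OF assms(5,6)]) blast
  define \<psi> where "\<psi> y = complex_of_real (\<phi> y)" for y
  define u where "u = (\<lambda>y. (-1) * g y + f y)"
  have S\<psi>: "S \<psi>" unfolding \<psi>_def
    by (rule smooth_on_bounded_linear_compose[OF bounded_linear_of_real Cinf_on_imp_smooth_on[OF \<phi>(1)]])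
  have Su: "S u" unfolding u_def by (intro smooth_intros assms)
  have "\<psi> y * u y = 0" if "y \<in> M" for y
  proof (cases "y \<in> V")
    case False
    then have "y \<in> U" using \<phi>(3) by blast
    then show ?thesis using \<phi>(4) by (simp add: \<psi>_def)
  qed (use assms(7) that in \<open>simp add: u_def\<close>)
  then have "br (\<lambda>y. \<psi> y * u y) h x = br (\<lambda>y. 0) h x"
    by (intro br_cong smooth_intros S\<psi> Su assms) auto
  moreover have "\<psi> x = 1" "u x = 0" using \<phi>(6,8) assms(4,6,7) by (auto simp: \<psi>_def u_def)
  ultimately have "br u h x = 0"
    using br_mult[OF S\<psi> Su assms(3,4)] br_zero[OF assms(3,4)] by simp
  moreover have "br u h x = (-1) * br g h x + br f h x"
    unfolding u_def by (rule br_lin[OF assms(2,1,3,4)])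
  ultimately show ?thesis by simp
qed

lemma br_local2:
  assumes "S f" "S f'" "S g" "S g'" "x \<in> M" "open V" "x \<in> V" "\<And>y. y \<in> M \<Longrightarrow> y \<in> V \<Longrightarrow> f y = f' y"
    "open W" "x \<in> W" "\<And>y. y \<in> M \<Longrightarrow> y \<in> W \<Longrightarrow> g y = g' y"
  shows "br f g x = br f' g' x"
  using br_local[OF assms(1,2,3,5-8)] br_local[OF assms(3,4,2,5,9-11)]
    br_antisym[OF assms(2,3,5)] br_antisym[OF assms(2,4,5)] by metis

text \<open>By Hadamard's lemma, \<open>h\<close> agrees near \<open>x\<close> with \<open>h x + \<Sum> l\<^sub>b g\<^sub>b\<close>, where \<open>l\<^sub>b\<close> is the coordinate
  \<open>y\<^sub>b\<close> shifted to vanish at \<open>x\<close> and \<open>g\<^sub>b x\<close> is the partial derivative. In the Leibniz rule the terms with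
  the factor \<open>l\<^sub>b x\<close> disappear.\<close>

lemma br_chain:
  assumes h: "S h" and f: "S f" and x: "x \<in> M" and V: "open V" "x \<in> V" and H: "Cinf_on V H"
    and eq: "\<And>y. y \<in> M \<Longrightarrow> y \<in> V \<Longrightarrow> H y = h y"
  shows "br h f x = (\<Sum>b\<in>Basis. frechet_derivative H (at x) b * br (cartesian b) f x)"
proof -
  obtain r where r: "r > 0" "ball x r \<subseteq> V" using V openE by blast
  have "Cinf_on (ball x r) H" using H r(2) Ck_on_subset by blast
  then obtain G where G: "\<And>b. Cinf_on (ball x r) (G b)" "\<And>b. G b x = frechet_derivative H (at x) b"
    "\<And>y. y \<in> ball x r \<Longrightarrow> H y = H x + (\<Sum>b\<in>Basis. ((y - x) \<bullet> b) *\<^sub>R G b y)"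
    using hadamard[OF _ r(1)] by metis
  have "\<exists>g W. Cinf_on UNIV g \<and> open W \<and> x \<in> W \<and> W \<subseteq> ball x r \<and> (\<forall>y\<in>W. g y = G b y)" for b
    using Cinf_extend[OF open_ball _ G(1), of x b] r(1) by (metis centre_in_ball)
  then obtain g W where g: "\<And>b. Cinf_on UNIV (g b)" "\<And>b. open (W b)" "\<And>b. x \<in> W b"
    "\<And>b. W b \<subseteq> ball x r" "\<And>b y. y \<in> W b \<Longrightarrow> g b y = G b y" by metis
  have Sg: "S (g b)" for b using g(1) Cinf_on_imp_smooth_on by blast
  define l where "l b y = cartesian b y + (- cartesian b x)" for b y
  have Sl: "S (l b)" for b unfolding l_def by (intro smooth_intros)
  define k where "k y = H x + (\<Sum>b\<in>Basis. l b y * g b y)" for y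
  have Sk: "S k" unfolding k_def by (intro smooth_intros Sl Sg)
  define U where "U = ball x r \<inter> (\<Inter>b\<in>Basis. W b)"
  have U: "open U" "x \<in> U" unfolding U_def using g(2,3) r(1) by (auto intro!: open_Int open_INT)
  have "br h f x = br k f x"
  proof (rule br_local[OF h Sk f x U])
    fix y assume y: "y \<in> M" "y \<in> U"
    then have "y \<in> ball x r" by (simp add: U_def)
    then have "h y = H x + (\<Sum>b\<in>Basis. ((y - x) \<bullet> b) *\<^sub>R G b y)"
      using G(3)[of y] eq[OF y(1) subsetD[OF r(2)]] by (simp del: mem_ball)
    also have "(\<Sum>b\<in>Basis. ((y - x) \<bullet> b) *\<^sub>R G b y) = (\<Sum>b\<in>Basis. l b y * g b y)"
      using y g(5) by (intro sum.cong) (auto simp: U_def l_def scaleR_conv_of_real inner_diff_left)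
    finally show "h y = k y" by (simp add: k_def)
  qed
  also have "\<dots> = (\<Sum>b\<in>Basis. br (\<lambda>y. l b y * g b y) f x)"
    unfolding k_def using f x
    by (simp add: br_add br_const br_sum smooth_on_const smooth_on_sum smooth_on_mult Sl Sg)
  also have "\<dots> = (\<Sum>b\<in>Basis. frechet_derivative H (at x) b * br (cartesian b) f x)"
  proof (rule sum.cong[OF refl])
    fix b :: 'a
    have "br (l b) f x = br (cartesian b) f x"
      unfolding l_def br_add[OF smooth_on_cartesian smooth_on_const f x] br_const[OF f x] by simp
    moreover have "l b x = 0" by (simp add: l_def)
    moreover have "g b x = frechet_derivative H (at x) b" using g(3,5) G(2) by simp
    ultimately show "br (\<lambda>y. l b y * g b y) f x = frechet_derivative H (at x) b * br (cartesian b) f x"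
      using br_mult[OF Sl Sg f x] by simp
  qed
  finally show ?thesis .
qed

lemma br_cartesian:
  assumes "S f" "x \<in> M"
  shows "br (cartesian u) f x = (\<Sum>b\<in>Basis. complex_of_real (u \<bullet> b) * br (cartesian b) f x)"
proof -
  have "cartesian u = (\<lambda>y. \<Sum>b\<in>Basis. complex_of_real (u \<bullet> b) * cartesian b y)"
    by (rule ext, subst euclidean_inner) (simp add: mult.commute)
  then have "br (cartesian u) f x = br (\<lambda>y. \<Sum>b\<in>Basis. complex_of_real (u \<bullet> b) * cartesian b y) f x" by simp
  also have "\<dots> = (\<Sum>b\<in>Basis. complex_of_real (u \<bullet> b) * br (cartesian b) f x)"
    using assms by (simp add: br_sum br_cmult smooth_on_cmult smooth_on_cartesian)
  finally show ?thesis .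
qed

lemma hamiltonian_vector_inner:
  assumes "S h" "x \<in> M"
  shows "hamiltonian_vector br h x \<bullet> u = Re (- \<i> * br (cartesian u) h x)"
proof -
  have "hamiltonian_vector br h x \<bullet> u = (\<Sum>b\<in>Basis. Re (- \<i> * br (cartesian b) h x) * (b \<bullet> u))"
    by (simp add: hamiltonian_vector_def inner_sum_left)
  also have "\<dots> = Re (- \<i> * br (cartesian u) h x)"
    by (subst br_cartesian[OF assms, of u]) (simp add: inner_commute[of u] mult.commute)
  finally show ?thesis .
qed

text \<open>Conjugation fixes \<open>f\<close> and \<open>h\<close>, so the reality convention reads \<open>{f, h} = - {f, h}\<^sup>*\<close>.\<close>

lemma br_real:
  assumes "S f" "S h" "x \<in> M" "\<And>y. y \<in> M \<Longrightarrow> f y \<in> \<real>" "\<And>y. y \<in> M \<Longrightarrow> h y \<in> \<real>"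
  shows "Re (br f h x) = 0"
proof -
  have "br f h x = br (\<lambda>y. cnj (f y)) (\<lambda>y. cnj (h y)) x"
    using assms by (intro br_cong) (auto simp: Reals_cnj_iff)
  also have "\<dots> = - cnj (br f h x)" by (rule br_cnj[OF assms(1-3)])
  finally show ?thesis by (simp add: complex_eq_iff)
qed

text \<open>By locality all global representatives of the germs give the same value, so the definite
  description in \<^const>\<open>local_bracket\<close> is resolved by any of them.\<close>

lemma local_bracket_eq:
  assumes "S F" "S G" "x \<in> M" "open V" "x \<in> V" "\<And>y. y \<in> M \<Longrightarrow> y \<in> V \<Longrightarrow> F y = f y"
    "open W" "x \<in> W" "\<And>y. y \<in> M \<Longrightarrow> y \<in> W \<Longrightarrow> G y = g y"
  shows "local_bracket M br f g x = br F G x"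
  unfolding local_bracket_def
proof (rule the_equality)
  show "\<exists>F' G' V. S F' \<and> S G' \<and> open V \<and> x \<in> V \<and> (\<forall>y\<in>M \<inter> V. F' y = f y \<and> G' y = g y) \<and> br F G x = br F' G' x"
    using assms by (intro exI[of _ F] exI[of _ G] exI[of _ "V \<inter> W"]) auto
next
  fix c assume "\<exists>F' G' V. S F' \<and> S G' \<and> open V \<and> x \<in> V \<and> (\<forall>y\<in>M \<inter> V. F' y = f y \<and> G' y = g y) \<and> c = br F' G' x"
  then obtain F' G' V' where *: "S F'" "S G'" "open V'" "x \<in> V'" "\<forall>y\<in>M \<inter> V'. F' y = f y \<and> G' y = g y"
    "c = br F' G' x" by blast
  have "br F' G' x = br F G x"
    by (rule br_local2[of _ _ _ _ _ "V \<inter> V'" "W \<inter> V'"]) (use assms * in auto)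
  with * show "c = br F G x" by simp
qed

section \<open>Hamiltonian arcs and zeros of Hamiltonian vector fields\<close>

text \<open>Running backwards along an integral curve of \<open>h\<close> is an integral curve of \<open>- h\<close>.\<close>

lemma hamiltonian_arc_sym:
  assumes "hamiltonian_arc M br p q" shows "hamiltonian_arc M br q p"
proof -
  obtain h c a b where h: "smooth_real_on M h" and ab: "a \<le> b" "c a = p" "c b = q"
    and c: "\<And>s. s \<in> {a..b} \<Longrightarrow> c s \<in> M \<and>
           (c has_vector_derivative hamiltonian_vector br h (c s)) (at s within {a..b})"
    using assms unfolding hamiltonian_arc_def by blast
  have Sh: "S h" using h by (simp add: smooth_real_on_def)
  let ?h = "\<lambda>y. (-1) * h y" and ?c = "\<lambda>s. c (a + b - s)"
  have neg: "hamiltonian_vector br ?h x = - hamiltonian_vector br h x" if "x \<in> M" for x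
    using br_cmult_right[OF Sh smooth_on_cartesian that, of _ "-1"]
    by (simp add: hamiltonian_vector_def sum_negf)
  have "?c s \<in> M \<and> (?c has_vector_derivative hamiltonian_vector br ?h (?c s)) (at s within {a..b})"
    if s: "s \<in> {a..b}" for s
  proof -
    have s': "a + b - s \<in> {a..b}" using s by auto
    have "((\<lambda>s. a + b - s) has_vector_derivative -1) (at s within {a..b})"
      by (auto intro!: derivative_eq_intros)
    moreover have "(c has_vector_derivative hamiltonian_vector br h (?c s)) (at (a + b - s) within (\<lambda>s. a + b - s) ` {a..b})"
      using c[OF s'] by simp
    ultimately have "(c \<circ> (\<lambda>s. a + b - s) has_vector_derivative (-1) *\<^sub>R hamiltonian_vector br h (?c s)) (at s within {a..b})"
      by (rule vector_diff_chain_within)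
    then show ?thesis using c[OF s'] neg by (simp add: o_def)
  qed
  moreover have "smooth_real_on M ?h" using h smooth_on_cmult[of M h "-1"] by (auto simp: smooth_real_on_def)
  ultimately show ?thesis unfolding hamiltonian_arc_def using ab
    by (intro exI[of _ ?h] exI[of _ ?c] exI[of _ a] exI[of _ b]) auto
qed

text \<open>Near the zero \<open>N\<close> the estimate comes from differentiability at \<open>N\<close>; at distance at least \<open>\<delta>\<close> the
  field is bounded by compactness, say by \<open>C\<close>, and \<open>C / \<delta>\<close> is a suitable constant.\<close>

lemma hamiltonian_vector_Lipschitz:
  assumes M: "compact M" and N: "N \<in> M" and h: "S h" and z: "hamiltonian_vector br h N = 0"
  obtains L where "\<And>y. y \<in> M \<Longrightarrow> norm (hamiltonian_vector br h y) \<le> L * norm (y - N)"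
proof -
  let ?X = "hamiltonian_vector br h"
  have comp: "\<exists>L. \<forall>y\<in>M. norm (?X y \<bullet> u) \<le> L * norm (y - N)" for u
  proof -
    let ?f = "\<lambda>y. ?X y \<bullet> u"
    have "smooth_on M (\<lambda>y. Re (- \<i> * br (cartesian u) h y))"
      by (rule smooth_on_bounded_linear_compose[OF bounded_linear_Re])
        (intro smooth_intros br_smooth h)
    then have f: "smooth_on M ?f"
      by (rule smooth_on_cong[THEN iffD1, rotated]) (simp add: hamiltonian_vector_inner[OF h])
    then obtain V F where F: "open V" "N \<in> V" "Cinf_on V F" "\<forall>y\<in>M \<inter> V. F y = ?f y"
      using N unfolding smooth_on_def by blast
    have FN: "F N = 0" using F(2,4) N z by auto
    have "F differentiable (at N)" using F(2,3) by (metis Ck_on.simps(2))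
    then obtain F' where F': "(F has_derivative F') (at N)" unfolding differentiable_def by blast
    obtain K where K: "\<And>v. norm (F' v) \<le> norm v * K"
      using bounded_linear.bounded[OF has_derivative_bounded_linear[OF F']] by blast
    obtain d where d: "d > 0" "\<And>y. norm (y - N) < d \<Longrightarrow> norm (F y - F N - F' (y - N)) \<le> 1 * norm (y - N)"
      using F' unfolding has_derivative_at_alt by (metis zero_less_one)
    obtain e where e: "e > 0" "ball N e \<subseteq> V" using F(1,2) openE by blast
    define \<delta> where "\<delta> = min d e"
    have \<delta>: "\<delta> > 0" using d(1) e(1) by (simp add: \<delta>_def)
    have near: "norm (?f y) \<le> (1 + K) * norm (y - N)" if "y \<in> M" "norm (y - N) < \<delta>" for y
    proof -
      have "y \<in> V" using that(2) e(2) by (auto simp: \<delta>_def dist_norm norm_minus_commute subset_eq)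
      then have "?f y = F y" using F(4) that(1) by auto
      moreover have "norm (F y - F' (y - N)) \<le> norm (y - N)"
        using d(2)[of y] that(2) FN by (simp add: \<delta>_def)
      moreover have "norm (F y) \<le> norm (F y - F' (y - N)) + norm (F' (y - N))"
        by (metis add.commute norm_triangle_sub)
      ultimately show ?thesis using K[of "y - N"] by (simp add: algebra_simps)
    qed
    have "compact (?f ` M)" using compact_continuous_image[OF smooth_on_imp_continuous_on[OF f] M] .
    then obtain C where C: "C > 0" "\<And>y. y \<in> M \<Longrightarrow> norm (?f y) \<le> C"
      using compact_imp_bounded bounded_pos by (metis imageI)
    have "norm (?f y) \<le> max (1 + K) (C / \<delta>) * norm (y - N)" if "y \<in> M" for y
    proof (cases "norm (y - N) < \<delta>")
      case True
      then show ?thesis using near[OF that True]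
        by (meson max.cobounded1 mult_right_mono norm_ge_zero order_trans)
    next
      case False
      then have "C \<le> (C / \<delta>) * norm (y - N)" using C(1) \<delta> by (simp add: field_simps)
      then show ?thesis using C(2)[OF that]
        by (meson max.cobounded2 mult_right_mono norm_ge_zero order_trans)
    qed
    then show ?thesis by blast
  qed
  then obtain L where L: "\<And>u y. y \<in> M \<Longrightarrow> norm (?X y \<bullet> u) \<le> L u * norm (y - N)" by metis
  have "norm (?X y) \<le> (\<Sum>b\<in>Basis. L b) * norm (y - N)" if "y \<in> M" for y
  proof -
    have "norm (?X y) \<le> (\<Sum>b\<in>Basis. \<bar>?X y \<bullet> b\<bar>)" by (rule norm_le_l1)
    also have "\<dots> \<le> (\<Sum>b\<in>Basis. L b * norm (y - N))" using L[OF that] by (intro sum_mono) auto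
    finally show ?thesis by (simp add: sum_distrib_right)
  qed
  then show ?thesis using that by blast
qed

text \<open>Gronwall's argument: \<open>exp (- 2 L s) |c s - N|\<^sup>2\<close> is nonincreasing, nonnegative, and \<open>0\<close> at the
  start.\<close>

lemma integral_curve_stays_at_zero:
  fixes c :: "real \<Rightarrow> 'a" and X :: "'a \<Rightarrow> 'a"
  assumes "a \<le> b" "c a = N"
    and c: "\<And>s. s \<in> {a..b} \<Longrightarrow> (c has_vector_derivative X (c s)) (at s within {a..b})"
    and L: "\<And>s. s \<in> {a..b} \<Longrightarrow> norm (X (c s)) \<le> L * norm (c s - N)"
  shows "c b = N"
proof -
  define g where "g s = exp (- 2 * L * s) * ((c s - N) \<bullet> (c s - N))" for s
  have "g b \<le> g a"
  proof (rule DERIV_nonpos_imp_decreasing_open[OF assms(1)])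
    fix s assume s: "a < s" "s < b"
    then have s': "s \<in> {a..b}" by auto
    have "(c has_vector_derivative X (c s)) (at s)"
      using c[OF s'] at_within_Icc_at[OF s] by simp
    then have "((\<lambda>s. c s - N) has_derivative (\<lambda>h. h *\<^sub>R X (c s))) (at s)"
      unfolding has_vector_derivative_def
      by (rule has_derivative_diff[OF _ has_derivative_const, simplified])
    from has_derivative_inner[OF this this]
    have "DERIV (\<lambda>s. (c s - N) \<bullet> (c s - N)) s :> 2 * (X (c s) \<bullet> (c s - N))"
      unfolding has_field_derivative_def
      by (rule has_derivative_eq_rhs) (simp add: fun_eq_iff inner_commute[of _ "X (c s)"])
    moreover have "DERIV (\<lambda>s. exp (- 2 * L * s)) s :> exp (- 2 * L * s) * (- 2 * L)"
      by (auto intro!: derivative_eq_intros)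
    ultimately have "DERIV g s :> exp (- 2 * L * s) * (- 2 * L) * ((c s - N) \<bullet> (c s - N))
        + 2 * (X (c s) \<bullet> (c s - N)) * exp (- 2 * L * s)"
      unfolding g_def by (intro DERIV_mult)
    then have "DERIV g s :> exp (- 2 * L * s) * (2 * (X (c s) \<bullet> (c s - N)) - 2 * L * ((c s - N) \<bullet> (c s - N)))"
      by (rule DERIV_cong) (simp add: algebra_simps)
    moreover have "X (c s) \<bullet> (c s - N) \<le> L * ((c s - N) \<bullet> (c s - N))"
    proof -
      have "X (c s) \<bullet> (c s - N) \<le> norm (X (c s)) * norm (c s - N)" by (rule norm_cauchy_schwarz)
      also have "\<dots> \<le> L * norm (c s - N) * norm (c s - N)" by (intro mult_right_mono L s') auto
      finally show ?thesis by (simp add: dot_square_norm power2_eq_square)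
    qed
    then have "exp (- 2 * L * s) * (2 * (X (c s) \<bullet> (c s - N)) - 2 * L * ((c s - N) \<bullet> (c s - N))) \<le> 0"
      by (intro mult_nonneg_nonpos) auto
    ultimately show "\<exists>y. DERIV g s :> y \<and> y \<le> 0" by blast
  next
    have "continuous_on {a..b} c"
      unfolding continuous_on_eq_continuous_within
      using has_vector_derivative_continuous[OF c] by blast
    then show "continuous_on {a..b} g" unfolding g_def by (intro continuous_intros)
  qed
  then have "(c b - N) \<bullet> (c b - N) \<le> 0" by (simp add: g_def assms(2) mult_le_0_iff not_le[symmetric])
  then show ?thesis by (metis eq_iff_diff_eq_0 inner_eq_zero_iff inner_ge_zero order_antisym)
qed

lemma hamiltonian_arc_singular:
  assumes M: "compact M" and z: "\<And>h. smooth_real_on M h \<Longrightarrow> hamiltonian_vector br h N = 0"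
    and arc: "hamiltonian_arc M br N q"
  shows "q = N"
proof -
  obtain h c a b where h: "smooth_real_on M h" and ab: "a \<le> b" "c a = N" "c b = q"
    and c: "\<And>s. s \<in> {a..b} \<Longrightarrow> c s \<in> M \<and>
           (c has_vector_derivative hamiltonian_vector br h (c s)) (at s within {a..b})"
    using arc unfolding hamiltonian_arc_def by blast
  have N: "N \<in> M" using c[of a] ab by auto
  obtain L where "\<And>y. y \<in> M \<Longrightarrow> norm (hamiltonian_vector br h y) \<le> L * norm (y - N)"
    using hamiltonian_vector_Lipschitz[OF M N _ z[OF h]] h by (auto simp: smooth_real_on_def)
  then show ?thesis
    using integral_curve_stays_at_zero[of a b c N "hamiltonian_vector br h" L] ab c by auto
qed

end

section \<open>The sphere and the chart \<open>z = a / t\<close>\<close>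

lemma even_sphere_iff: "x \<in> even_sphere \<longleftrightarrow> fst x \<bullet> fst x = snd x * (1 - snd x)"
  by (simp add: even_sphere_def inner_vec_def flip: power2_norm_eq_inner)

lemma compact_even_sphere: "compact (even_sphere :: ((complex ^ 'n::finite) \<times> real) set)"
proof -
  have "norm x \<le> 1" if "x \<in> even_sphere" for x :: "(complex ^ 'n) \<times> real"
  proof -
    have "0 \<le> snd x * (1 - snd x)" using that inner_ge_zero[of "fst x"] by (simp add: even_sphere_iff)
    then have "snd x \<le> 1" by (auto simp: zero_le_mult_iff)
    moreover have "x \<bullet> x = snd x"
      using that by (cases x) (simp add: even_sphere_iff algebra_simps)
    ultimately have "(norm x)\<^sup>2 \<le> 1" by (simp add: power2_norm_eq_inner)
    then show ?thesis by (simp add: power_le_one_iff abs_square_le_1)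
  qed
  then have "bounded (even_sphere :: ((complex ^ 'n) \<times> real) set)" unfolding bounded_iff by blast
  moreover have "closed (even_sphere :: ((complex ^ 'n) \<times> real) set)"
  proof -
    have "even_sphere = {x :: (complex ^ 'n) \<times> real. fst x \<bullet> fst x = snd x * (1 - snd x)}"
      using even_sphere_iff by blast
    moreover have "closed {x :: (complex ^ 'n) \<times> real. fst x \<bullet> fst x = snd x * (1 - snd x)}"
      by (intro closed_Collect_eq continuous_intros)
    ultimately show ?thesis by (simp only:)
  qed
  ultimately show ?thesis by (simp add: compact_eq_bounded_closed)
qed

lemma north_pole_in_even_sphere: "north_pole \<in> even_sphere"
  by (simp add: even_sphere_iff north_pole_def)

lemma snd_ne_0_iff_not_north_pole:
  assumes "x \<in> even_sphere" shows "snd x \<noteq> 0 \<longleftrightarrow> x \<noteq> north_pole"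
  using assms by (cases x) (auto simp: even_sphere_iff north_pole_def)

text \<open>The inverse of the chart: on the sphere, \<open>|a|\<^sup>2 = t (1 - t)\<close> amounts to \<open>t (1 + |z|\<^sup>2) = 1\<close>.\<close>

definition unchart :: "complex ^ 'n \<Rightarrow> (complex ^ 'n::finite) \<times> real" where
  "unchart z = inverse (1 + z \<bullet> z) *\<^sub>R (z, 1)"

lemma one_plus_inner_pos: "1 + z \<bullet> z > (0::real)"
  using inner_ge_zero[of z] by linarith

lemma snd_unchart: "snd (unchart z) = inverse (1 + z \<bullet> z)"
  and fst_unchart: "fst (unchart z) = inverse (1 + z \<bullet> z) *\<^sub>R z"
  by (simp_all add: unchart_def)

lemma unchart_in: "unchart z \<in> even_sphere - {north_pole}"
proof -
  have "unchart z \<in> even_sphere"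
    using one_plus_inner_pos[of z] by (simp add: even_sphere_iff snd_unchart fst_unchart field_simps)
  moreover have "snd (unchart z) \<noteq> 0" using one_plus_inner_pos[of z] by (simp add: snd_unchart)
  ultimately show ?thesis using snd_ne_0_iff_not_north_pole by blast
qed

lemma chart_eq: "(\<chi> i. coord_z i x) = inverse (snd x) *\<^sub>R fst x"
  by (simp add: vec_eq_iff coord_z_def coord_a_def coord_t_def scaleR_conv_of_real[where 'a=complex] divide_inverse mult.commute)

lemma chart_unchart: "(\<chi> i. coord_z i (unchart z)) = z"
  using one_plus_inner_pos[of z] by (simp add: chart_eq snd_unchart fst_unchart)

lemma unchart_chart:
  assumes "x \<in> even_sphere - {north_pole}"
  shows "unchart (\<chi> i. coord_z i x) = x"
proof -
  have t: "snd x \<noteq> 0" using assms snd_ne_0_iff_not_north_pole by blast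
  have "fst x \<bullet> fst x = snd x * (1 - snd x)" using assms by (simp add: even_sphere_iff)
  then have "1 + (\<chi> i. coord_z i x) \<bullet> (\<chi> i. coord_z i x) = inverse (snd x)"
    using t by (simp add: chart_eq field_simps)
  then show ?thesis using t by (simp add: unchart_def chart_eq prod_eq_iff)
qed

lemma open_chart_domain: "open {x :: (complex ^ 'n::finite) \<times> real. snd x \<noteq> 0}"
  by (intro open_Collect_neq continuous_intros)

lemma Cinf_on_chart:
  "Cinf_on {x :: (complex ^ 'n::finite) \<times> real. snd x \<noteq> 0} (\<lambda>x. \<chi> i. coord_z i x)"
proof
  fix k
  note o = open_chart_domain
  show "Ck_on k {x :: (complex ^ 'n) \<times> real. snd x \<noteq> 0} (\<lambda>x. \<chi> i. coord_z i x)"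
    unfolding chart_eq
    by (rule Ck_on_scaleR[OF o Ck_on_inverse[OF o Ck_on_linear[OF o bounded_linear_snd]]
          Ck_on_linear[OF o bounded_linear_fst]]) simp
qed

lemma Cinf_on_unchart: "Cinf_on UNIV (unchart :: complex ^ 'n::finite \<Rightarrow> _)"
proof
  fix k
  have id: "Ck_on k UNIV (\<lambda>z :: complex ^ 'n. z)"
    by (rule Ck_on_linear[OF open_UNIV bounded_linear_ident])
  have "Ck_on k UNIV (\<lambda>z :: complex ^ 'n. inverse (1 + z \<bullet> z))"
    by (rule Ck_on_inverse[OF open_UNIV Ck_on_add[OF open_UNIV Ck_on_const[OF open_UNIV]
            Ck_on_inner[OF open_UNIV id id]]])
      (metis one_plus_inner_pos less_irrefl)
  moreover have "Ck_on k UNIV (\<lambda>z :: complex ^ 'n. (z, 0) + (0, 1::real))"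
    by (rule Ck_on_add[OF open_UNIV Ck_on_linear[OF open_UNIV] Ck_on_const[OF open_UNIV]])
      (intro bounded_linear_intros)
  ultimately show "Ck_on k UNIV (unchart :: complex ^ 'n \<Rightarrow> _)"
    using Ck_on_scaleR[OF open_UNIV, of k "\<lambda>z. inverse (1 + z \<bullet> z)" "\<lambda>z. (z, 0) + (0, 1::real)"]
    by (simp add: unchart_def[abs_def])
qed

lemma diffeomorphism_chart:
  "diffeomorphism_between (even_sphere - {north_pole}) (UNIV :: (complex ^ 'n::finite) set)
      (\<lambda>x. \<chi> i. coord_z i x)"
proof -
  let ?M = "even_sphere - {north_pole} :: ((complex ^ 'n) \<times> real) set"
  let ?f = "\<lambda>x :: (complex ^ 'n) \<times> real. \<chi> i. coord_z i x"
  have bij: "bij_betw ?f ?M UNIV"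
    by (rule bij_betw_byWitness[where f' = unchart])
      (intro ballI unchart_chart chart_unchart subset_UNIV image_subsetI unchart_in; assumption)+
  have "the_inv_into ?M ?f z = unchart z" for z
    by (rule the_inv_into_f_eq[OF bij_betw_imp_inj_on[OF bij] chart_unchart unchart_in])
  then have "the_inv_into ?M ?f = unchart" by (rule ext)
  then have "smooth_on UNIV (the_inv_into ?M ?f)"
    using Cinf_on_imp_smooth_on[OF Cinf_on_unchart] by simp
  moreover have "smooth_on ?M ?f"
    by (rule smooth_onI_open[OF open_chart_domain _ Cinf_on_chart])
      (use snd_ne_0_iff_not_north_pole in auto)
  ultimately show ?thesis using bij by (simp add: diffeomorphism_between_def)
qed

section \<open>Linear functions in terms of the coordinates\<close>

lemma smooth_coord_a: "smooth_on M (coord_a i)"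
proof -
  have "bounded_linear (\<lambda>x. fst x $ i :: complex)"
    using bounded_linear_compose[OF bounded_linear_vec_nth bounded_linear_fst] .
  then show ?thesis using smooth_on_linear by (simp add: coord_a_def[abs_def])
qed

lemma coord_a_star_eq: "coord_a_star i = (\<lambda>x. cnj (coord_a i x))"
  by (simp add: fun_eq_iff coord_a_star_def)

lemma smooth_coord_a_star: "smooth_on M (coord_a_star i)"
  unfolding coord_a_star_eq by (intro smooth_on_cnj smooth_coord_a)

lemma coord_t_eq: "coord_t = cartesian (0, 1)"
  by (simp add: fun_eq_iff coord_t_def inner_prod_def)

lemma smooth_coord_t: "smooth_on M coord_t"
  unfolding coord_t_eq by (rule smooth_on_cartesian)

lemmas smooth_coords = smooth_coord_a smooth_coord_a_star smooth_coord_t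

lemma cartesian_axis:
  "cartesian (axis j w, 0) = (\<lambda>y :: (complex ^ 'n::finite) \<times> real. (cnj w / 2) * coord_a j y + (w / 2) * coord_a_star j y)"
proof
  fix y :: "(complex ^ 'n) \<times> real"
  show "cartesian (axis j w, 0) y = (cnj w / 2) * coord_a j y + (w / 2) * coord_a_star j y"
    by (simp add: inner_prod_def inner_axis inner_complex_def coord_a_star_def coord_a_def complex_eq_iff)
      (simp add: field_simps)
qed

lemma cartesian_coords:
  "cartesian \<xi> = (\<lambda>y :: (complex ^ 'n::finite) \<times> real. (\<Sum>k\<in>UNIV. (cnj (fst \<xi> $ k) / 2) * coord_a k y + (fst \<xi> $ k / 2) * coord_a_star k y)
      + complex_of_real (snd \<xi>) * coord_t y)"
proof
  fix y :: "(complex ^ 'n) \<times> real"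
  have "complex_of_real (z \<bullet> w) = (cnj w / 2) * z + (w / 2) * cnj z" for z w :: complex
    by (simp add: inner_complex_def complex_eq_iff) (simp add: field_simps)
  then show "cartesian \<xi> y = (\<Sum>k\<in>UNIV. (cnj (fst \<xi> $ k) / 2) * coord_a k y + (fst \<xi> $ k / 2) * coord_a_star k y)
      + complex_of_real (snd \<xi>) * coord_t y"
    by (simp add: inner_prod_def inner_vec_def coord_a_star_def coord_a_def coord_t_def mult.commute)
qed

lemma sum_split_at:
  fixes j :: "'n::{finite,linorder}" and f :: "'n \<Rightarrow> 'a::comm_monoid_add"
  shows "sum f UNIV = sum f {..<j} + f j + sum f {j<..}"
proof -
  have "UNIV = {..<j} \<union> {j} \<union> {j<..}" by auto
  then have "sum f UNIV = sum f ({..<j} \<union> {j} \<union> {j<..})" by simp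
  also have "\<dots> = sum f ({..<j} \<union> {j}) + sum f {j<..}" by (rule sum.union_disjoint) auto
  also have "sum f ({..<j} \<union> {j}) = sum f {..<j} + f j" by (subst sum.union_disjoint) auto
  finally show ?thesis .
qed

section \<open>Nondegeneracy away from the pole\<close>

text \<open>The covector \<open>\<Sum> (c\<^sub>k da\<^sub>k + c\<^sub>k\<^sup>* da\<^sub>k\<^sup>*) + \<tau> dt\<close> annihilates the Hamiltonian vectors of \<open>t\<close> and of all
  \<open>a\<^sub>j\<close>, which is expressed by \<open>Et\<close> and \<open>Ej\<close>; then it is a multiple of the differential of
  \<open>\<Sum> a\<^sub>k a\<^sub>k\<^sup>* - t + t\<^sup>2\<close>. Put \<open>u\<^sub>k = c\<^sub>k a\<^sub>k\<close>; by \<open>Et\<close> the sum \<open>R\<close> of all \<open>u\<^sub>k\<close> is real. The factor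
  \<open>\<mu>\<close> is forced by the solution \<open>c\<^sub>k = \<mu> a\<^sub>k\<^sup>*\<close>, for which \<open>R + \<tau> t = \<mu> t\<^sup>2\<close>. Once \<open>c\<^sub>k\<close> is known for
  \<open>k < j\<close>, the sum over \<open>k > j\<close> in the \<open>j\<close>-th equation is \<open>R\<close> minus the other terms, which leaves an
  equation for \<open>c\<^sub>j\<close> alone. This is the induction. It divides by \<open>T j\<close>, which is positive because
  \<open>t \<noteq> 0\<close>.\<close>

lemma annihilator_of_brackets:
  fixes a c :: "'n::{finite,linorder} \<Rightarrow> complex" and t \<tau> :: real
  defines "T \<equiv> \<lambda>j. t\<^sup>2 + (\<Sum>l\<in>{..<j}. (cmod (a l))\<^sup>2)"
  assumes t: "t \<noteq> 0" and sph: "(\<Sum>l\<in>UNIV. (cmod (a l))\<^sup>2) = t * (1 - t)"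
    and Et: "(\<Sum>k\<in>UNIV. c k * a k - cnj (c k * a k)) = 0"
    and Ej: "\<And>j. (\<Sum>k\<in>UNIV. c k * (if j < k then a j * a k else if k < j then - (a j * a k) else 0)
        + cnj (c k) * (if k = j then 2 * of_real (T j) - 2 * a j * cnj (a j) else - 3 * a j * cnj (a k)))
        - 2 * of_real \<tau> * of_real t * a j = 0"
  obtains \<mu> :: real where "\<And>k. c k = of_real \<mu> * cnj (a k)" "\<tau> = \<mu> * (2 * t - 1)"
proof -
  define e where "e j k = c k * (if j < k then a j * a k else if k < j then - (a j * a k) else 0)
        + cnj (c k) * (if k = j then 2 * of_real (T j) - 2 * a j * cnj (a j) else - 3 * a j * cnj (a k))" for j k
  define u where "u k = c k * a k" for k
  define R where "R = (\<Sum>k\<in>UNIV. Re (u k))"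
  define \<mu> where "\<mu> = (R + \<tau> * t) / t\<^sup>2"
  have T_pos: "T j > 0" for j
    unfolding T_def using t by (intro add_pos_nonneg sum_nonneg) auto
  have total: "(\<Sum>k\<in>UNIV. u k) = of_real R"
  proof -
    have "2 * (\<Sum>k\<in>UNIV. Im (u k)) = Im (\<Sum>k\<in>UNIV. u k - cnj (u k))"
      by (simp add: sum_distrib_left)
    then have "(\<Sum>k\<in>UNIV. Im (u k)) = 0" using Et by (simp only: u_def) simp
    then show ?thesis by (simp add: complex_eq_iff R_def)
  qed
  have c: "c j = of_real \<mu> * cnj (a j)" for j
  proof (induction j rule: measure_induct_rule[of "\<lambda>j. card {..<j}"])
    case (less j)
    have IH: "c k = of_real \<mu> * cnj (a k)" if "k < j" for k
    proof (rule less)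
      show "card {..<k} < card {..<j}" using that by (intro psubset_card_mono) auto
    qed
    define P where "P = (\<Sum>k\<in>{j<..}. u k)"
    define Q where "Q = (\<Sum>k\<in>{..<j}. u k)"
    have "u k = of_real (\<mu> * (cmod (a k))\<^sup>2)" if "k < j" for k
      unfolding u_def IH[OF that] of_real_mult complex_norm_square by simp
    then have "Q = (\<Sum>k\<in>{..<j}. of_real (\<mu> * (cmod (a k))\<^sup>2))"
      unfolding Q_def by (intro sum.cong) auto
    then have Q: "Q = of_real (\<mu> * (T j - t\<^sup>2))" by (simp add: T_def sum_distrib_left)
    have P: "P = of_real R - Q - u j"
      using total sum_split_at[of u j] by (simp add: P_def Q_def algebra_simps)
    have Qc: "cnj Q = Q" by (simp add: Q)
    \<comment> \<open>The equation \<open>Ej\<close> with the sum split into the parts below, at and above \<open>j\<close>.\<close>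
    have "a j * (P - 3 * cnj P - Q - 3 * cnj Q - 2 * cnj (u j) - 2 * of_real \<tau> * of_real t)
        + 2 * of_real (T j) * cnj (c j) = 0"
    proof -
      have "(\<Sum>k\<in>{..<j}. e j k) = (\<Sum>k\<in>{..<j}. a j * (- u k - 3 * cnj (u k)))"
        by (rule sum.cong) (auto simp: e_def u_def algebra_simps)
      also have "\<dots> = a j * (- Q - 3 * cnj Q)"
        unfolding sum_distrib_left[symmetric] sum_subtractf sum_negf Q_def by (simp add: sum_distrib_left)
      finally have 1: "(\<Sum>k\<in>{..<j}. e j k) = a j * (- Q - 3 * cnj Q)" .
      have "(\<Sum>k\<in>{j<..}. e j k) = (\<Sum>k\<in>{j<..}. a j * (u k - 3 * cnj (u k)))"
        by (rule sum.cong) (auto simp: e_def u_def algebra_simps)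
      also have "\<dots> = a j * (P - 3 * cnj P)"
        unfolding sum_distrib_left[symmetric] sum_subtractf P_def by (simp add: sum_distrib_left)
      finally have 2: "(\<Sum>k\<in>{j<..}. e j k) = a j * (P - 3 * cnj P)" .
      show ?thesis
        using Ej[of j, folded e_def] unfolding sum_split_at[of _ j] 1 2 by (simp add: e_def u_def algebra_simps)
    qed
    \<comment> \<open>Since \<open>P\<close> is eliminated, the coefficient of \<open>a j\<close> involves only \<open>\<mu>\<close>, \<open>T j\<close> and \<open>Im (u j)\<close>.\<close>
    then have key: "of_real (T j) * cnj (c j) = a j * (of_real (\<mu> * T j) + \<i> * of_real (Im (u j)))"
    proof -
      assume eq: "a j * (P - 3 * cnj P - Q - 3 * cnj Q - 2 * cnj (u j) - 2 * of_real \<tau> * of_real t)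
        + 2 * of_real (T j) * cnj (c j) = 0"
      have "R + \<tau> * t = \<mu> * t\<^sup>2" using t by (simp add: \<mu>_def)
      then have "- (P - 3 * cnj P - Q - 3 * cnj Q - 2 * cnj (u j) - 2 * of_real \<tau> * of_real t)
        = 2 * (of_real (\<mu> * T j) + \<i> * of_real (Im (u j)))"
        unfolding P Q by (simp add: complex_eq_iff algebra_simps)
      moreover have "2 * of_real (T j) * cnj (c j)
        = a j * - (P - 3 * cnj P - Q - 3 * cnj Q - 2 * cnj (u j) - 2 * of_real \<tau> * of_real t)"
        using eq by (simp only: add_eq_0_iff mult_minus_right)
      ultimately have "2 * of_real (T j) * cnj (c j) = a j * (2 * (of_real (\<mu> * T j) + \<i> * of_real (Im (u j))))"
        by (simp only:)
      then show ?thesis by (simp only: mult.assoc mult.left_commute[of "a j" 2] mult_cancel_left) simp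
    qed
    \<comment> \<open>Multiplied by \<open>a\<^sub>j\<^sup>*\<close> this becomes an equation for \<open>u j\<close>, in whose imaginary part the two sides
      have opposite signs.\<close>
    have "of_real (T j) * cnj (u j) = of_real ((cmod (a j))\<^sup>2) * (of_real (\<mu> * T j) + \<i> * of_real (Im (u j)))"
    proof -
      have "of_real (T j) * cnj (u j) = (of_real (T j) * cnj (c j)) * cnj (a j)" by (simp add: u_def)
      also have "\<dots> = of_real ((cmod (a j))\<^sup>2) * (of_real (\<mu> * T j) + \<i> * of_real (Im (u j)))"
        unfolding key complex_norm_square by (simp only: mult_ac)
      finally show ?thesis .
    qed
    from arg_cong[OF this, of Im] have "(T j + (cmod (a j))\<^sup>2) * Im (u j) = 0" by (simp add: algebra_simps)
    then have "Im (u j) = 0" using T_pos[of j] by (smt (verit) mult_eq_0_iff zero_le_power2)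
    with key have "of_real (T j) * cnj (c j) = of_real (T j) * (of_real \<mu> * a j)" by (simp add: mult_ac)
    then have "cnj (c j) = of_real \<mu> * a j" using T_pos[of j] by simp
    then show ?case by (metis complex_cnj_cnj complex_cnj_mult complex_cnj_complex_of_real)
  qed
  have "R = \<mu> * (t * (1 - t))"
  proof -
    have "Re (u k) = \<mu> * (cmod (a k))\<^sup>2" for k
      by (simp add: u_def c cmod_power2) (simp add: power2_eq_square algebra_simps)
    then show ?thesis by (simp add: R_def sph flip: sum_distrib_left)
  qed
  moreover have "R + \<tau> * t = \<mu> * t\<^sup>2" using t by (simp add: \<mu>_def)
  ultimately have "t * \<tau> = t * (\<mu> * (2 * t - 1))" by (simp add: algebra_simps power2_eq_square)
  then have "\<tau> = \<mu> * (2 * t - 1)" using t by simp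
  with c show ?thesis by (rule that)
qed

section \<open>The bracket on the sphere\<close>

text \<open>The functions \<open>a\<^sub>i, a\<^sub>i\<^sup>*, t\<close> generate all linear functions, so the listed brackets, together with
  antisymmetry and the reality convention, determine all brackets of linear functions.\<close>

locale sphere_poisson = poisson_manifold even_sphere br
  for br :: "((complex ^ 'n::{finite,linorder}) \<times> real \<Rightarrow> complex) \<Rightarrow>
      ((complex ^ 'n::{finite,linorder}) \<times> real \<Rightarrow> complex) \<Rightarrow> (complex ^ 'n::{finite,linorder}) \<times> real \<Rightarrow> complex" +
  assumes br_a_a: "\<And>k l x. k < l \<Longrightarrow> x \<in> even_sphere \<Longrightarrow>
        br (coord_a k) (coord_a l) x = coord_a k x * coord_a l x"
    and br_a_a_star: "\<And>k l x. k \<noteq> l \<Longrightarrow> x \<in> even_sphere \<Longrightarrow>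
        br (coord_a k) (coord_a_star l) x = - 3 * coord_a k x * coord_a_star l x"
    and br_a_t: "\<And>i x. x \<in> even_sphere \<Longrightarrow>
        br (coord_a i) coord_t x = - 2 * coord_a i x * coord_t x"
    and br_a_a_star_same: "\<And>k x. x \<in> even_sphere \<Longrightarrow>
        br (coord_a k) (coord_a_star k) x =
          2 * (coord_t x)\<^sup>2 + 2 * (\<Sum>l\<in>{..<k}. coord_a l x * coord_a_star l x)
            - 2 * coord_a k x * coord_a_star k x"
begin

abbreviation ham_arc where "ham_arc \<equiv> hamiltonian_arc even_sphere br"

lemma br_self: "S f \<Longrightarrow> x \<in> even_sphere \<Longrightarrow> br f f x = 0"
  using br_antisym[of f f x] by (simp add: complex_eq_iff)

lemma br_a_a': "x \<in> even_sphere \<Longrightarrow> br (coord_a j) (coord_a k) x =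
    (if j < k then coord_a j x * coord_a k x else if k < j then - (coord_a j x * coord_a k x) else 0)"
  using br_a_a[of j k x] br_a_a[of k j x] br_antisym[OF smooth_coord_a smooth_coord_a, of x j k]
    br_self[OF smooth_coord_a, of x j]
  by (cases j k rule: linorder_cases) auto

lemma br_t_t: "x \<in> even_sphere \<Longrightarrow> br coord_t coord_t x = 0"
  by (rule br_self[OF smooth_coord_t])

lemma br_t_a: "x \<in> even_sphere \<Longrightarrow> br coord_t (coord_a i) x = 2 * coord_a i x * coord_t x"
  using br_antisym[OF smooth_coord_t smooth_coord_a, of x i] br_a_t[of x i] by simp

lemma br_a_star_real:
  assumes h: "smooth_real_on even_sphere h" and x: "x \<in> even_sphere"
  shows "br (coord_a_star j) h x = - cnj (br (coord_a j) h x)"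
proof -
  have S: "S h" and r: "\<And>y. y \<in> even_sphere \<Longrightarrow> h y \<in> \<real>"
    using h by (simp_all only: smooth_real_on_def)
  have "br (coord_a_star j) h x = br (\<lambda>y. cnj (coord_a j y)) (\<lambda>y. cnj (h y)) x"
    by (rule br_cong[OF smooth_coord_a_star S _ _ x])
      (simp_all only: coord_a_star_def r[unfolded Reals_cnj_iff])
  also have "\<dots> = - cnj (br (coord_a j) h x)" by (rule br_cnj[OF smooth_coord_a S x])
  finally show ?thesis .
qed

lemma coord_t_real: "smooth_real_on even_sphere coord_t"
  by (auto simp only: smooth_real_on_def smooth_coord_t coord_t_def Reals_of_real)

lemma br_t_a_star:
  assumes x: "x \<in> even_sphere"
  shows "br coord_t (coord_a_star i) x = - 2 * coord_a_star i x * coord_t x"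
  using br_antisym[OF smooth_coord_t smooth_coord_a_star x, of i] br_a_star_real[OF coord_t_real x, of i]
    br_a_t[OF x, of i] by (simp add: coord_a_star_def coord_t_def)

lemma br_axis:
  assumes h: "smooth_real_on even_sphere h" and x: "x \<in> even_sphere"
  shows "br (cartesian (axis j w, 0)) h x
    = (cnj w / 2) * br (coord_a j) h x - (w / 2) * cnj (br (coord_a j) h x)"
proof -
  have S: "S h" using h by (simp only: smooth_real_on_def)
  show ?thesis
    unfolding cartesian_axis
    using br_add[OF smooth_on_cmult[OF smooth_coord_a] smooth_on_cmult[OF smooth_coord_a_star] S x,
        of "cnj w / 2" j "w / 2" j]
      br_cmult[OF smooth_coord_a S x, of "cnj w / 2" j] br_cmult[OF smooth_coord_a_star S x, of "w / 2" j]
      br_a_star_real[OF h x, of j] by simp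
qed

lemma hamiltonian_vector_coords:
  assumes h: "smooth_real_on even_sphere h" and x: "x \<in> even_sphere"
  shows "fst (hamiltonian_vector br h x) $ j = - \<i> * br (coord_a j) h x"
    and "snd (hamiltonian_vector br h x) = Re (- \<i> * br coord_t h x)"
proof -
  let ?X = "hamiltonian_vector br h x"
  have S: "S h" using h by (simp only: smooth_real_on_def)
  have "Re (fst ?X $ j) = ?X \<bullet> (axis j 1, 0)" "Im (fst ?X $ j) = ?X \<bullet> (axis j \<i>, 0)"
    by (simp_all add: inner_prod_def inner_axis)
  then have "Re (fst ?X $ j) = Im (br (coord_a j) h x)" "Im (fst ?X $ j) = - Re (br (coord_a j) h x)"
    unfolding hamiltonian_vector_inner[OF S x] br_axis[OF h x] by simp_all
  then show "fst ?X $ j = - \<i> * br (coord_a j) h x" by (simp add: complex_eq_iff)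
  have "snd ?X = ?X \<bullet> (0, 1)" by (simp add: inner_prod_def)
  then show "snd ?X = Re (- \<i> * br coord_t h x)"
    unfolding hamiltonian_vector_inner[OF S x] coord_t_eq[symmetric] .
qed

section \<open>The pole is a leaf\<close>

lemma br_cartesian_coords:
  assumes g: "S g" and x: "x \<in> even_sphere"
  shows "br (cartesian \<xi>) g x
    = (\<Sum>k\<in>UNIV. (cnj (fst \<xi> $ k) / 2) * br (coord_a k) g x + (fst \<xi> $ k / 2) * br (coord_a_star k) g x)
      + complex_of_real (snd \<xi>) * br coord_t g x"
proof -
  let ?f = "\<lambda>k y. (cnj (fst \<xi> $ k) / 2) * coord_a k y + (fst \<xi> $ k / 2) * coord_a_star k y"
  have S1: "S (\<lambda>y. c * coord_a k y)" and S2: "S (\<lambda>y. c * coord_a_star k y)" for c k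
    by (rule smooth_on_cmult smooth_coords)+
  have Sf: "S (?f k)" for k by (rule smooth_on_add[OF S1 S2])
  have "br (cartesian \<xi>) g x = (\<Sum>k\<in>UNIV. br (?f k) g x) + complex_of_real (snd \<xi>) * br coord_t g x"
    unfolding cartesian_coords[of \<xi>] br_add[OF smooth_on_sum[OF Sf] smooth_on_cmult[OF smooth_coord_t] g x]
      br_sum[OF Sf g x] br_cmult[OF smooth_coord_t g x] ..
  then show ?thesis
    unfolding br_add[OF S1 S2 g x] br_cmult[OF smooth_coord_a g x] br_cmult[OF smooth_coord_a_star g x] .
qed

text \<open>All brackets of linear functions contain a factor that vanishes at the pole; the chain rule extends
  this to an arbitrary second argument.\<close>

lemma brackets_vanish_at_pole:
  assumes h: "S h"
  shows "br (coord_a j) h north_pole = 0" "br coord_t h north_pole = 0"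
proof -
  note N = north_pole_in_even_sphere
  have N0: "coord_a k north_pole = 0" "coord_a_star k north_pole = 0" "coord_t north_pole = 0" for k
    by (simp_all add: coord_a_def coord_a_star_def coord_t_def north_pole_def)
  have as: "br (coord_a k) (coord_a_star j) north_pole = 0" for j k
    using br_a_a_star[OF _ N, of k j] br_a_a_star_same[OF N, of j] by (cases "k = j") (simp_all add: N0)
  have sa: "br (coord_a_star k) (coord_a j) north_pole = 0" for j k
    using br_antisym[OF smooth_coord_a_star smooth_coord_a N, of k j] as by simp
  have st: "br (coord_a_star k) coord_t north_pole = 0" for k
    using br_antisym[OF smooth_coord_a_star smooth_coord_t N, of k] br_t_a_star[OF N, of k] by (simp add: N0)
  have aa: "br (coord_a k) (coord_a j) north_pole = 0" for j k
    by (simp add: br_a_a'[OF N] N0)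
  have ca: "br (cartesian \<xi>) (coord_a j) north_pole = 0" for \<xi>
    unfolding br_cartesian_coords[OF smooth_coord_a N] by (simp add: aa br_t_a[OF N] sa N0)
  have ct: "br (cartesian \<xi>) coord_t north_pole = 0" for \<xi>
    unfolding br_cartesian_coords[OF smooth_coord_t N] by (simp add: br_a_t[OF N] br_t_t[OF N] st N0)
  obtain V H where H: "open V" "north_pole \<in> V" "Cinf_on V H"
    "\<And>y. y \<in> even_sphere \<Longrightarrow> y \<in> V \<Longrightarrow> H y = h y" by (rule smooth_onE[OF h N]) blast
  have "br h (coord_a j) north_pole = 0"
    by (subst br_chain[OF h smooth_coord_a N H]) (simp_all add: ca)
  then show "br (coord_a j) h north_pole = 0" using br_antisym[OF smooth_coord_a h N] by simp
  have "br h coord_t north_pole = 0"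
    by (subst br_chain[OF h smooth_coord_t N H]) (simp_all add: ct)
  then show "br coord_t h north_pole = 0" using br_antisym[OF smooth_coord_t h N] by simp
qed

lemma hamiltonian_vector_pole:
  assumes "smooth_real_on even_sphere h" shows "hamiltonian_vector br h north_pole = 0"
  using hamiltonian_vector_coords[OF assms north_pole_in_even_sphere] brackets_vanish_at_pole[of h] assms
  by (simp add: prod_eq_iff vec_eq_iff smooth_real_on_def)

section \<open>The complement of the pole is a leaf\<close>

text \<open>The curve is \<open>z\<^sub>k = s w\<close>, \<open>0 \<le> s \<le> 1\<close>, with the other coordinates fixed, and \<open>h = Im (a\<^sub>k w\<^sup>*)\<close>. Along
  it \<open>t = \<tau> s = 1 / (\<alpha> + s\<^sup>2 \<beta>)\<close>, where \<open>\<beta> = |w|\<^sup>2\<close>, and \<open>a\<^sub>k w\<^sup>*\<close> is real. That \<open>z\<^sub>j = 0\<close> for \<open>j > k\<close>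
  enters twice: these coordinates then stay \<open>0\<close>, and \<open>\<alpha> - 1\<close> is the sum over \<open>l < k\<close> that occurs in
  \<open>{a\<^sub>k, a\<^sub>k\<^sup>*}\<close>.\<close>

lemma radial_arc:
  fixes z :: "(complex, 'n) vec"
  assumes top: "\<And>j. k < j \<Longrightarrow> z $ j = 0"
  shows "ham_arc (unchart (\<chi> j. if j = k then 0 else z $ j)) (unchart z)"
proof -
  define w where "w = z $ k"
  define z0 where "z0 = (\<chi> j. if j = k then 0 else z $ j)"
  define \<alpha> where "\<alpha> = 1 + z0 \<bullet> z0"
  define \<beta> where "\<beta> = (cmod w)\<^sup>2"
  define p where "p s = z0 + s *\<^sub>R axis k w" for s :: real
  define \<tau> where "\<tau> s = inverse (\<alpha> + s\<^sup>2 * \<beta>)" for s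
  define c where "c s = (\<tau> s *\<^sub>R p s, \<tau> s)" for s
  define h where "h = (\<lambda>y. (- \<i> / 2 * cnj w) * coord_a k y + (\<i> / 2 * w) * coord_a_star k y)"
  have pj: "p s $ j = (if j = k then of_real s * w else z $ j)" for s j
    by (simp add: p_def z0_def axis_def scaleR_conv_of_real[where 'a=complex])
  have norm_p: "1 + p s \<bullet> p s = \<alpha> + s\<^sup>2 * \<beta>" for s
  proof -
    have "z0 \<bullet> axis k w = 0" by (simp add: inner_axis z0_def)
    then show ?thesis
      unfolding p_def \<alpha>_def \<beta>_def power2_norm_eq_inner
      by (simp add: inner_add_left inner_add_right inner_commute[of "axis k w"] inner_axis_axis power2_eq_square)
  qed
  have D: "\<alpha> + s\<^sup>2 * \<beta> > 0" for s using one_plus_inner_pos[of "p s"] by (simp add: norm_p)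
  have c: "c s = unchart (p s)" for s
    by (simp add: c_def unchart_def \<tau>_def norm_p)
  have p1: "p 1 = z" and p0: "p 0 = z0" by (auto simp: vec_eq_iff pj z0_def w_def)
  have alpha: "\<alpha> = 1 + (\<Sum>l\<in>{..<k}. (cmod (z $ l))\<^sup>2)"
  proof -
    have "z0 \<bullet> z0 = (\<Sum>l\<in>UNIV. (cmod (z0 $ l))\<^sup>2)" by (simp add: inner_vec_def power2_norm_eq_inner)
    also have "\<dots> = (\<Sum>l\<in>{..<k}. (cmod (z0 $ l))\<^sup>2)"
    proof -
      have "(\<Sum>l\<in>{k<..}. (cmod (z0 $ l))\<^sup>2) = 0" by (rule sum.neutral) (auto simp: top z0_def)
      then show ?thesis
        using sum_split_at[of "\<lambda>l. (cmod (z0 $ l))\<^sup>2" k] by (simp add: z0_def)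
    qed
    also have "\<dots> = (\<Sum>l\<in>{..<k}. (cmod (z $ l))\<^sup>2)" by (rule sum.cong) (auto simp: z0_def)
    finally show ?thesis by (simp add: \<alpha>_def)
  qed
  have h: "smooth_real_on even_sphere h"
  proof -
    have "h y \<in> \<real>" for y by (simp add: h_def coord_a_star_def complex_is_Real_iff)
    moreover have "S h" unfolding h_def by (intro smooth_on_add smooth_on_cmult smooth_coords)
    ultimately show ?thesis by (simp add: smooth_real_on_def)
  qed
  have br_h: "br f h x = (- \<i> / 2 * cnj w) * br f (coord_a k) x + (\<i> / 2 * w) * br f (coord_a_star k) x"
    if "S f" "x \<in> even_sphere" for f x
    unfolding h_def br_add_right[OF smooth_on_cmult[OF smooth_coord_a] smooth_on_cmult[OF smooth_coord_a_star] that]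
      br_cmult_right[OF smooth_coord_a that] br_cmult_right[OF smooth_coord_a_star that] ..
  have in_M: "c s \<in> even_sphere" for s using unchart_in[of "p s"] by (simp add: c)
  have coords: "coord_a j (c s) = of_real (\<tau> s) * (if j = k then of_real s * w else z $ j)"
    "coord_t (c s) = of_real (\<tau> s)" for j s
    by (simp_all add: coord_a_def coord_t_def c_def pj scaleR_conv_of_real[where 'a=complex])
  have ww: "w * cnj w = of_real \<beta>" unfolding \<beta>_def complex_norm_square ..
  have \<tau>': "(\<tau> has_real_derivative - 2 * s * \<beta> * (\<tau> s)\<^sup>2) (at s within T)" for s T
    unfolding \<tau>_def using D[of s] by (auto intro!: derivative_eq_intros simp: power2_eq_square field_simps)
  have flow: "hamiltonian_vector br h (c s)
      = ((- 2 * s * \<beta> * (\<tau> s)\<^sup>2) *\<^sub>R p s + \<tau> s *\<^sub>R axis k w, - 2 * s * \<beta> * (\<tau> s)\<^sup>2)" (is "?X = ?Y") for s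
  proof -
    note X = hamiltonian_vector_coords[OF h in_M[of s]]
    have "fst ?X $ j = fst ?Y $ j" for j
    proof (cases j k rule: linorder_cases)
      case less
      have "fst ?X $ j = - \<i> * ((- \<i> / 2 * cnj w) * (coord_a j (c s) * coord_a k (c s))
          + (\<i> / 2 * w) * (- 3 * coord_a j (c s) * coord_a_star k (c s)))"
        using less unfolding X br_h[OF smooth_coord_a in_M] by (simp add: br_a_a in_M br_a_a_star)
      also have "\<dots> = - (2 * of_real s * of_real (\<tau> s) ^ 2 * z $ j * (w * cnj w))"
        using less by (auto simp: coords coord_a_star_def algebra_simps power2_eq_square)
      finally show ?thesis using less unfolding ww by (auto simp: pj axis_def scaleR_conv_of_real[where 'a=complex] algebra_simps)
    next
      case equal
      have sum: "(\<Sum>l\<in>{..<k}. coord_a l (c s) * coord_a_star l (c s)) = of_real ((\<tau> s)\<^sup>2 * (\<alpha> - 1))"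
      proof -
        have "coord_a l (c s) * coord_a_star l (c s) = of_real ((\<tau> s)\<^sup>2 * (cmod (z $ l))\<^sup>2)" if "l < k" for l
          unfolding of_real_mult complex_norm_square coord_a_star_def coords using that
          by (auto simp: power2_eq_square)
        then have "(\<Sum>l\<in>{..<k}. coord_a l (c s) * coord_a_star l (c s))
          = (\<Sum>l\<in>{..<k}. of_real ((\<tau> s)\<^sup>2 * (cmod (z $ l))\<^sup>2))" by (intro sum.cong) auto
        then show ?thesis by (simp add: alpha sum_distrib_left)
      qed
      have aa: "coord_a k (c s) * coord_a_star k (c s) = of_real ((\<tau> s)\<^sup>2 * s\<^sup>2) * (w * cnj w)"
        by (simp add: coords coord_a_star_def power2_eq_square)
      have "fst ?X $ k = - \<i> * ((\<i> / 2 * w) * (2 * of_real (\<tau> s) ^ 2 + 2 * of_real ((\<tau> s)\<^sup>2 * (\<alpha> - 1))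
          - 2 * (coord_a k (c s) * coord_a_star k (c s))))"
        unfolding X br_h[OF smooth_coord_a in_M] br_a_a_star_same[OF in_M] sum
        by (simp add: br_self[OF smooth_coord_a in_M] coords mult.assoc)
      also have "\<dots> = of_real ((\<tau> s)\<^sup>2 * \<alpha> - (\<tau> s)\<^sup>2 * s\<^sup>2 * \<beta>) * w"
        unfolding aa ww by (simp add: algebra_simps)
      also have "(\<tau> s)\<^sup>2 * \<alpha> - (\<tau> s)\<^sup>2 * s\<^sup>2 * \<beta> = - 2 * s * \<beta> * (\<tau> s)\<^sup>2 * s + \<tau> s"
      proof -
        have "\<tau> s = (\<tau> s)\<^sup>2 * (\<alpha> + s\<^sup>2 * \<beta>)" using D[of s] by (simp add: \<tau>_def power2_eq_square)
        then show ?thesis by (simp add: algebra_simps power2_eq_square)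
      qed
      finally show ?thesis unfolding equal by (simp add: pj axis_def scaleR_conv_of_real[where 'a=complex] algebra_simps)
    next
      case greater
      then show ?thesis
        using top unfolding X br_h[OF smooth_coord_a in_M]
        by (simp add: br_a_a' in_M br_a_a_star coords pj axis_def)
    qed
    moreover have "snd ?X = snd ?Y"
    proof -
      have "br coord_t h (c s) = \<i> * (- 2 * of_real s * of_real (\<tau> s) ^ 2 * (w * cnj w))"
        unfolding br_h[OF smooth_coord_t in_M] br_t_a[OF in_M] br_t_a_star[OF in_M]
        by (simp add: coords coord_a_star_def power2_eq_square)
      then show ?thesis unfolding X ww by (simp add: algebra_simps power2_eq_square)
    qed
    ultimately show ?thesis by (simp add: prod_eq_iff vec_eq_iff)
  qed
  have "(c has_vector_derivative hamiltonian_vector br h (c s)) (at s within {0..1})" for s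
  proof -
    have p': "(p has_vector_derivative axis k w) (at s within {0..1})"
      unfolding p_def[abs_def] by (auto intro!: derivative_eq_intros)
    have "(c has_vector_derivative (\<tau> s *\<^sub>R axis k w + (- 2 * s * \<beta> * (\<tau> s)\<^sup>2) *\<^sub>R p s,
        - 2 * s * \<beta> * (\<tau> s)\<^sup>2)) (at s within {0..1})"
      unfolding c_def[abs_def]
      by (rule has_vector_derivative_Pair[OF has_vector_derivative_scaleR[OF \<tau>' p']
            \<tau>'[unfolded has_real_derivative_iff_has_vector_derivative]])
    then show ?thesis unfolding flow by (simp only: add.commute)
  qed
  then have "hamiltonian_arc even_sphere br (c 0) (c 1)"
    unfolding hamiltonian_arc_def using h in_M
    by (intro exI[of _ h] exI[of _ c] exI[of _ 0] exI[of _ 1]) auto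
  then show ?thesis by (simp add: c p0 p1 z0_def)
qed

text \<open>Induction on the number of nonzero coordinates: the last one, \<open>z\<^sub>k\<close>, is switched on by a radial
  arc.\<close>

lemma arcs_from_origin: "ham_arc\<^sup>*\<^sup>* (unchart 0) (unchart z)"
proof (induction "card {j. z $ j \<noteq> 0}" arbitrary: z rule: less_induct)
  case less
  show ?case
  proof (cases "z = 0")
    case False
    then have ne: "{j. z $ j \<noteq> 0} \<noteq> {}" by (auto simp: vec_eq_iff)
    define k where "k = Max {j. z $ j \<noteq> 0}"
    define z0 where "z0 = (\<chi> j. if j = k then 0 else z $ j)"
    have k: "z $ k \<noteq> 0" using Max_in[OF _ ne] by (simp add: k_def)
    have top: "z $ j = 0" if "k < j" for j
      using that Max_ge[of "{j. z $ j \<noteq> 0}" j] unfolding k_def by (auto simp: not_le[symmetric])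
    have "card {j. z0 $ j \<noteq> 0} < card {j. z $ j \<noteq> 0}"
      using k by (intro psubset_card_mono) (auto simp: z0_def)
    then have "ham_arc\<^sup>*\<^sup>* (unchart 0) (unchart z0)" by (rule less)
    also have "ham_arc (unchart z0) (unchart z)" unfolding z0_def by (rule radial_arc) (rule top)
    finally show ?thesis .
  qed simp
qed

lemma arcs_sym: "ham_arc\<^sup>*\<^sup>* p q \<Longrightarrow> ham_arc\<^sup>*\<^sup>* q p"
  by (metis hamiltonian_arc_sym sympI symp_rtranclp sympD)

lemma arcs_from_pole: "ham_arc\<^sup>*\<^sup>* north_pole q \<Longrightarrow> q = north_pole"
proof (induction rule: rtranclp_induct)
  case (step y z)
  then show ?case
    using hamiltonian_arc_singular[OF compact_even_sphere hamiltonian_vector_pole] by blast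
qed simp

lemma leaf_class:
  assumes "p \<in> even_sphere"
  shows "leaf_relation even_sphere br `` {p} = (if p = north_pole then {north_pole} else even_sphere - {north_pole})"
proof (cases "p = north_pole")
  case True
  then show ?thesis using arcs_from_pole north_pole_in_even_sphere by (auto simp: leaf_relation_def)
next
  case False
  have reach: "ham_arc\<^sup>*\<^sup>* (unchart 0) q" if "q \<in> even_sphere - {north_pole}" for q
    using arcs_from_origin[of "\<chi> i. coord_z i q"] unchart_chart[OF that] by simp
  have "ham_arc\<^sup>*\<^sup>* p q \<longleftrightarrow> q \<noteq> north_pole" if "q \<in> even_sphere" for q
  proof
    assume "ham_arc\<^sup>*\<^sup>* p q"
    then show "q \<noteq> north_pole" using False arcs_from_pole arcs_sym by blast
  next
    assume "q \<noteq> north_pole"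
    then show "ham_arc\<^sup>*\<^sup>* p q"
      using arcs_sym[OF reach[of p]] reach[of q] False assms that by (meson DiffI rtranclp_trans singletonD)
  qed
  then show ?thesis using assms False by (auto simp: leaf_relation_def)
qed

lemma symplectic_leaves_sphere:
  "symplectic_leaves even_sphere br = {{north_pole}, even_sphere - {north_pole}}"
proof -
  have "symplectic_leaves even_sphere br = (\<lambda>p. leaf_relation even_sphere br `` {p}) ` even_sphere"
    by (auto simp: symplectic_leaves_def quotient_def)
  also have "\<dots> = (\<lambda>p :: (complex, 'n) vec \<times> real. if p = north_pole then {north_pole} else even_sphere - {north_pole}) ` even_sphere"
    by (intro image_cong refl) (simp only: leaf_class)
  also have "\<dots> = {{north_pole}, even_sphere - {north_pole}}"
  proof -
    have "unchart 0 \<in> even_sphere" "unchart 0 \<noteq> north_pole" using unchart_in by blast+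
    then show ?thesis using north_pole_in_even_sphere by (auto simp: image_iff)
  qed
  finally show ?thesis .
qed

section \<open>Dimensions of the leaves\<close>

text \<open>The gradient of \<open>\<Sum> |a\<^sub>i|\<^sup>2 - t + t\<^sup>2\<close>, the defining function of the sphere.\<close>

definition sphere_normal :: "(complex, 'n) vec \<times> real \<Rightarrow> (complex, 'n) vec \<times> real" where
  "sphere_normal x = (2 *\<^sub>R fst x, 2 * snd x - 1)"

text \<open>The defining function of the sphere represents the zero function on the sphere; so by the chain rule
  its gradient is orthogonal to every Hamiltonian vector.\<close>

lemma hamiltonian_vector_tangent:
  assumes h: "smooth_real_on even_sphere h" and x: "x \<in> even_sphere"
  shows "hamiltonian_vector br h x \<bullet> sphere_normal x = 0"
proof -
  have S: "S h" using h by (simp only: smooth_real_on_def)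
  define H where "H y = complex_of_real (fst y \<bullet> fst y + (- snd y + snd y * snd y))" for y :: "(complex, 'n) vec \<times> real"
  have H0: "H y = 0" if "y \<in> even_sphere" for y
    using that by (simp add: H_def even_sphere_iff algebra_simps flip: of_real_mult of_real_diff)
  have C: "Ck_on k UNIV H" for k
    unfolding H_def[abs_def]
    by (intro Ck_on_bounded_linear[OF open_UNIV bounded_linear_of_real] Ck_on_add[OF open_UNIV]
        Ck_on_inner[OF open_UNIV] Ck_on_mult[OF open_UNIV] Ck_on_linear[OF open_UNIV]
        bounded_linear_fst bounded_linear_snd bounded_linear_minus)
  have D: "(H has_derivative (\<lambda>v. complex_of_real (v \<bullet> sphere_normal x))) (at x)"
    unfolding H_def[abs_def] sphere_normal_def
    by (auto intro!: derivative_eq_intros simp: fun_eq_iff inner_prod_def inner_commute[of "fst x"] algebra_simps)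
  have "br (\<lambda>y. 0) h x = (\<Sum>b\<in>Basis. frechet_derivative H (at x) b * br (cartesian b) h x)"
    by (rule br_chain[OF smooth_on_const S x open_UNIV UNIV_I]) (use C H0 in auto)
  then have "(\<Sum>b\<in>Basis. complex_of_real (b \<bullet> sphere_normal x) * br (cartesian b) h x) = 0"
    unfolding frechet_derivative_at[OF D, symmetric] br_zero[OF S x] by simp
  then have "br (cartesian (sphere_normal x)) h x = 0"
    using br_cartesian[OF S x, of "sphere_normal x"] by (simp add: inner_commute)
  then show ?thesis unfolding hamiltonian_vector_inner[OF S x] by simp
qed

text \<open>If \<open>\<xi>\<close> is orthogonal to all Hamiltonian vectors, then the linear function \<open>f\<close> defined by \<open>\<xi>\<close> has zero
  bracket with every real linear function (it is purely imaginary anyway), hence with \<open>t\<close> and all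
  \<open>a\<^sub>j\<close>.\<close>

lemma hamiltonian_vectors_annihilator:
  assumes x: "x \<in> even_sphere" and ne: "x \<noteq> north_pole"
    and orth: "\<And>h. smooth_real_on even_sphere h \<Longrightarrow> hamiltonian_vector br h x \<bullet> \<xi> = 0"
  obtains \<mu> where "\<xi> = \<mu> *\<^sub>R sphere_normal x"
proof -
  define a where "a k = coord_a k x" for k
  define c where "c k = cnj (fst \<xi> $ k) / 2" for k
  define t where "t = snd x"
  define \<tau> where "\<tau> = snd \<xi>"
  have t: "t \<noteq> 0" using ne snd_ne_0_iff_not_north_pole[OF x] by (simp add: t_def)
  have sph: "(\<Sum>l\<in>UNIV. (cmod (a l))\<^sup>2) = t * (1 - t)"
    using x by (simp add: even_sphere_def a_def coord_a_def t_def)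
  have real_cart: "smooth_real_on even_sphere (cartesian u)" for u :: "(complex, 'n) vec \<times> real"
    by (auto simp: smooth_real_on_def smooth_on_cartesian)
  have zero: "br (cartesian \<xi>) (cartesian u) x = 0" for u
  proof -
    have "Im (br (cartesian \<xi>) (cartesian u) x) = 0"
      using orth[OF real_cart[of u]] unfolding hamiltonian_vector_inner[OF smooth_on_cartesian x] by simp
    moreover have "Re (br (cartesian \<xi>) (cartesian u) x) = 0"
      by (rule br_real[OF smooth_on_cartesian smooth_on_cartesian x]) auto
    ultimately show ?thesis by (simp add: complex_eq_iff)
  qed
  have "br (cartesian \<xi>) (coord_a j) x = 0" for j
  proof -
    have "coord_a j = (\<lambda>y. cartesian (axis j 1, 0) y + \<i> * cartesian (axis j \<i>, 0) y)"
      by (rule ext) (simp add: inner_prod_def inner_axis coord_a_def complex_eq_iff)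
    then show ?thesis
      using br_add_right[OF smooth_on_cartesian smooth_on_cmult[OF smooth_on_cartesian] smooth_on_cartesian x,
          of \<xi> "(axis j 1, 0)" \<i> "(axis j \<i>, 0)"]
        br_cmult_right[OF smooth_on_cartesian smooth_on_cartesian x, of \<xi> \<i> "(axis j \<i>, 0)"]
      by (simp only: zero) simp
  qed
  then have Ej: "(\<Sum>k\<in>UNIV. c k * br (coord_a k) (coord_a j) x + cnj (c k) * br (coord_a_star k) (coord_a j) x)
      + of_real \<tau> * br coord_t (coord_a j) x = 0" for j
    using br_cartesian_coords[OF smooth_coord_a x, of \<xi> j] by (simp add: c_def \<tau>_def)
  have "br (cartesian \<xi>) coord_t x = 0" unfolding coord_t_eq by (rule zero)
  then have Et: "(\<Sum>k\<in>UNIV. c k * br (coord_a k) coord_t x + cnj (c k) * br (coord_a_star k) coord_t x) = 0"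
    using br_cartesian_coords[OF smooth_coord_t x, of \<xi>] by (simp add: c_def br_t_t[OF x])
  have sa: "br (coord_a_star k) (coord_a j) x = - (if k = j
      then 2 * of_real (t\<^sup>2 + (\<Sum>l\<in>{..<j}. (cmod (a l))\<^sup>2)) - 2 * a j * cnj (a j) else - 3 * a j * cnj (a k))" for j k
    unfolding br_antisym[OF smooth_coord_a_star smooth_coord_a x]
    by (cases "k = j")
      (simp_all add: br_a_a_star br_a_a_star_same x a_def t_def coord_t_def coord_a_star_def
        complex_norm_square[simplified] distrib_left)
  have st: "br (coord_a_star k) coord_t x = 2 * cnj (a k) * of_real t" for k
    unfolding br_antisym[OF smooth_coord_a_star smooth_coord_t x] br_t_a_star[OF x]
    by (simp add: a_def t_def coord_t_def coord_a_star_def)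
  have Et': "(\<Sum>k\<in>UNIV. c k * a k - cnj (c k * a k)) = 0"
  proof -
    have "- 2 * of_real t * (\<Sum>k\<in>UNIV. c k * a k - cnj (c k * a k)) = 0"
      unfolding sum_distrib_left Et[symmetric]
      by (rule sum.cong) (simp_all add: br_a_t[OF x] st a_def t_def coord_t_def algebra_simps)
    then show ?thesis using t by simp
  qed
  have Ej': "(\<Sum>k\<in>UNIV. c k * (if j < k then a j * a k else if k < j then - (a j * a k) else 0)
        + cnj (c k) * (if k = j then 2 * of_real (t\<^sup>2 + (\<Sum>l\<in>{..<j}. (cmod (a l))\<^sup>2)) - 2 * a j * cnj (a j)
            else - 3 * a j * cnj (a k)))
        - 2 * of_real \<tau> * of_real t * a j = 0" (is "?E - _ = 0") for j
  proof -
    have "?E = - (\<Sum>k\<in>UNIV. c k * br (coord_a k) (coord_a j) x + cnj (c k) * br (coord_a_star k) (coord_a j) x)"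
      unfolding sum_negf[symmetric]
      by (rule sum.cong) (auto simp: br_a_a'[OF x] sa a_def)
    then have "?E = of_real \<tau> * br coord_t (coord_a j) x" using Ej[of j] by (simp only: add_eq_0_iff)
    also have "\<dots> = 2 * of_real \<tau> * of_real t * a j"
      by (simp add: br_t_a[OF x] a_def t_def coord_t_def)
    finally show ?thesis by (simp only: diff_self)
  qed
  obtain \<mu> :: real where \<mu>: "\<And>k. c k = of_real \<mu> * cnj (a k)" "\<tau> = \<mu> * (2 * t - 1)"
    using annihilator_of_brackets[OF t sph Et' Ej'] by blast
  have "fst \<xi> $ k = of_real \<mu> * (2 * fst x $ k)" for k
    using arg_cong[OF \<mu>(1)[of k], of "\<lambda>w. 2 * cnj w"] by (simp add: c_def a_def coord_a_def)
  then have "\<xi> = \<mu> *\<^sub>R sphere_normal x"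
    using \<mu>(2) by (simp add: prod_eq_iff vec_eq_iff sphere_normal_def \<tau>_def t_def scaleR_conv_of_real[where 'a=complex])
  then show ?thesis by (rule that)
qed

lemma sphere_normal_ne_0: "x \<in> even_sphere \<Longrightarrow> sphere_normal x \<noteq> 0"
  by (auto simp: sphere_normal_def prod_eq_iff even_sphere_iff)

text \<open>The orthogonal complement of the Hamiltonian vectors is the normal line, in a space of dimension
  \<open>2 n + 1\<close>.\<close>

lemma leaf_dimension_regular: "leaf_dimension even_sphere br (even_sphere - {north_pole}) (2 * CARD('n))"
  unfolding leaf_dimension_def
proof
  fix x :: "(complex, 'n) vec \<times> real" assume "x \<in> even_sphere - {north_pole}"
  then have x: "x \<in> even_sphere" "x \<noteq> north_pole" by auto
  let ?W = "{hamiltonian_vector br h x |h. smooth_real_on even_sphere h}"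
  have "{y \<in> UNIV. \<forall>w \<in> span ?W. orthogonal w y} = span {sphere_normal x}"
  proof (intro equalityI subsetI)
    fix y assume "y \<in> {y \<in> UNIV. \<forall>w \<in> span ?W. orthogonal w y}"
    then have "hamiltonian_vector br h x \<bullet> y = 0" if "smooth_real_on even_sphere h" for h
      using that span_base[of "hamiltonian_vector br h x" ?W] by (auto simp: orthogonal_def)
    then obtain \<mu> where "y = \<mu> *\<^sub>R sphere_normal x" using hamiltonian_vectors_annihilator[OF x] by metis
    then show "y \<in> span {sphere_normal x}" by (simp add: span_breakdown_eq)
  next
    fix y assume "y \<in> span {sphere_normal x}"
    then obtain \<mu> where y: "y = \<mu> *\<^sub>R sphere_normal x" by (auto simp: span_singleton)
    have "orthogonal y w" if "w \<in> span ?W" for w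
      using that
    proof (rule orthogonal_to_span)
      fix v assume "v \<in> ?W"
      then show "orthogonal y v"
        using hamiltonian_vector_tangent[OF _ x(1)] by (auto simp: y orthogonal_def inner_commute)
    qed
    then show "y \<in> {y \<in> UNIV. \<forall>w \<in> span ?W. orthogonal w y}" by (simp add: orthogonal_commute)
  qed
  moreover have "dim {y \<in> UNIV. \<forall>w \<in> span ?W. orthogonal w y} + dim (span ?W) = dim (UNIV :: ((complex, 'n) vec \<times> real) set)"
    by (rule dim_subspace_orthogonal_to_vectors) auto
  moreover have "dim (span {sphere_normal x}) = 1"
    using sphere_normal_ne_0[OF x(1)] by (simp add: dim_singleton)
  moreover have "DIM((complex, 'n) vec \<times> real) = 2 * CARD('n) + 1" by simp
  ultimately show "dim ?W = 2 * CARD('n)" by simp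
qed

lemma leaf_dimension_pole: "leaf_dimension even_sphere br {north_pole} 0"
proof -
  have "smooth_real_on even_sphere (\<lambda>y :: (complex, 'n) vec \<times> real. 0)" by (simp add: smooth_real_on_def smooth_on_const)
  then have "{hamiltonian_vector br h north_pole |h. smooth_real_on even_sphere h} = {0}"
    using hamiltonian_vector_pole by force
  then show ?thesis by (simp add: leaf_dimension_def)
qed

section \<open>Brackets in the chart\<close>

text \<open>The quotient rule for \<open>f = p / t\<close> and \<open>g = q / t\<close>, obtained without a bracket of \<open>1 / t\<close>: apply
  the Leibniz rule to \<open>p = f t\<close> and to \<open>q = g t\<close>.\<close>

lemma local_quotient_bracket:
  assumes x: "x \<in> even_sphere" "x \<noteq> north_pole"
    and f: "Cinf_on {y. snd y \<noteq> 0} f" "\<And>y. snd y \<noteq> 0 \<Longrightarrow> f y * coord_t y = p y" "S p"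
    and g: "Cinf_on {y. snd y \<noteq> 0} g" "\<And>y. snd y \<noteq> 0 \<Longrightarrow> g y * coord_t y = q y" "S q"
  shows "(coord_t x)\<^sup>2 * local_bracket even_sphere br f g x
    = br p q x - g x * br p coord_t x - f x * br coord_t q x"
proof -
  let ?V = "{y :: (complex, 'n) vec \<times> real. snd y \<noteq> 0}"
  have V: "open ?V" "x \<in> ?V"
    using snd_ne_0_iff_not_north_pole[OF x(1)] x(2) by (auto intro: open_chart_domain)
  obtain F W where F: "Cinf_on UNIV F" "open W" "x \<in> W" "W \<subseteq> ?V" "\<And>y. y \<in> W \<Longrightarrow> F y = f y"
    by (rule Cinf_extend[OF V f(1)]) blast
  obtain G U where G: "Cinf_on UNIV G" "open U" "x \<in> U" "U \<subseteq> ?V" "\<And>y. y \<in> U \<Longrightarrow> G y = g y"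
    by (rule Cinf_extend[OF V g(1)]) blast
  have SF: "S F" and SG: "S G" using F(1) G(1) by (simp_all add: Cinf_on_imp_smooth_on)
  note St = smooth_coord_t
  have lb: "local_bracket even_sphere br f g x = br F G x"
    by (rule local_bracket_eq[OF SF SG x(1) F(2,3,5) G(2,3,5)])
  have Fp: "p y = F y * coord_t y" if "y \<in> W" for y
  proof -
    have "snd y \<noteq> 0" using F(4) that by blast
    then show ?thesis using f(2)[of y] F(5)[OF that] by simp
  qed
  have Gq: "q y = G y * coord_t y" if "y \<in> U" for y
  proof -
    have "snd y \<noteq> 0" using G(4) that by blast
    then show ?thesis using g(2)[of y] G(5)[OF that] by simp
  qed
  have numF: "br p h x = F x * br coord_t h x + br F h x * coord_t x" if "S h" for h
  proof -
    have "br p h x = br (\<lambda>y. F y * coord_t y) h x"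
      by (rule br_local[OF f(3) smooth_on_mult[OF SF St] that x(1) F(2,3)]) (rule Fp)
    also have "\<dots> = F x * br coord_t h x + br F h x * coord_t x" by (rule br_mult[OF SF St that x(1)])
    finally show ?thesis .
  qed
  have numG: "br h q x = G x * br h coord_t x + br h G x * coord_t x" if "S h" for h
  proof -
    have "br h q x = br h (\<lambda>y. G y * coord_t y) x"
      by (rule br_local2[OF that that g(3) smooth_on_mult[OF SG St] x(1) open_UNIV UNIV_I refl G(2,3)])
        (rule Gq)
    also have "\<dots> = G x * br h coord_t x + br h G x * coord_t x" by (rule br_mult_right[OF SG St that x(1)])
    finally show ?thesis .
  qed
  have tt: "br coord_t coord_t x = 0" by (rule br_t_t[OF x(1)])
  have "br p q x = G x * br p coord_t x + br p G x * coord_t x" by (rule numG[OF f(3)])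
  also have "br p G x = F x * br coord_t G x + br F G x * coord_t x" by (rule numF[OF SG])
  finally have 1: "br p q x = G x * br p coord_t x + (F x * br coord_t G x + br F G x * coord_t x) * coord_t x" .
  have "br coord_t q x = br coord_t G x * coord_t x" using numG[OF St] tt by simp
  then show ?thesis unfolding lb 1 using F(3,5) G(3,5) by (simp add: algebra_simps power2_eq_square)
qed

lemma coord_a_eq_z: "snd y \<noteq> 0 \<Longrightarrow> coord_a k y = coord_z k y * coord_t y"
  and coord_a_star_eq_z: "snd y \<noteq> 0 \<Longrightarrow> coord_a_star k y = coord_z_star k y * coord_t y"
  by (simp_all add: coord_z_def coord_z_star_def coord_a_star_def coord_t_def)

lemma Cinf_on_coord_z: "Cinf_on {y :: (complex, 'n) vec \<times> real. snd y \<noteq> 0} (coord_z k)"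
  using Ck_on_bounded_linear[OF open_chart_domain bounded_linear_vec_nth[of k] spec[OF Cinf_on_chart]]
  by simp

lemma Cinf_on_coord_z_star: "Cinf_on {y :: (complex, 'n) vec \<times> real. snd y \<noteq> 0} (coord_z_star k)"
  unfolding coord_z_star_def[abs_def]
  by (rule allI, rule Ck_on_bounded_linear[OF open_chart_domain bounded_linear_cnj spec[OF Cinf_on_coord_z]])

lemma local_bracket_z_z:
  assumes x: "x \<in> even_sphere" "x \<noteq> north_pole" and "k < l"
  shows "local_bracket even_sphere br (coord_z k) (coord_z l) x = coord_z k x * coord_z l x"
proof -
  have t: "snd x \<noteq> 0" using snd_ne_0_iff_not_north_pole[OF x(1)] x(2) by simp
  have "(coord_t x)\<^sup>2 * local_bracket even_sphere br (coord_z k) (coord_z l) x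
    = (coord_t x)\<^sup>2 * (coord_z k x * coord_z l x)"
    by (subst local_quotient_bracket[OF x Cinf_on_coord_z coord_a_eq_z[symmetric] smooth_coord_a Cinf_on_coord_z coord_a_eq_z[symmetric] smooth_coord_a])
      (auto simp: br_a_a[OF assms(3) x(1)] br_a_t[OF x(1)] br_t_a[OF x(1)] coord_a_eq_z[OF t]
        power2_eq_square)
  then show ?thesis using t by (simp add: coord_t_def)
qed

lemma local_bracket_z_z_star:
  assumes x: "x \<in> even_sphere" "x \<noteq> north_pole" and "k \<noteq> l"
  shows "local_bracket even_sphere br (coord_z k) (coord_z_star l) x = coord_z k x * coord_z_star l x"
proof -
  have t: "snd x \<noteq> 0" using snd_ne_0_iff_not_north_pole[OF x(1)] x(2) by simp
  have "(coord_t x)\<^sup>2 * local_bracket even_sphere br (coord_z k) (coord_z_star l) x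
    = (coord_t x)\<^sup>2 * (coord_z k x * coord_z_star l x)"
    by (subst local_quotient_bracket[OF x Cinf_on_coord_z coord_a_eq_z[symmetric] smooth_coord_a Cinf_on_coord_z_star coord_a_star_eq_z[symmetric] smooth_coord_a_star])
      (auto simp: br_a_a_star[OF assms(3) x(1)] br_a_t[OF x(1)] br_t_a_star[OF x(1)] coord_a_eq_z[OF t]
        coord_a_star_eq_z[OF t] power2_eq_square)
  then show ?thesis using t by (simp add: coord_t_def)
qed

lemma local_bracket_z_z_star_same:
  assumes x: "x \<in> even_sphere" "x \<noteq> north_pole"
  shows "local_bracket even_sphere br (coord_z k) (coord_z_star k) x
      = 2 * (1 + (\<Sum>l\<in>{..k}. coord_z l x * coord_z_star l x))"
proof -
  have t: "snd x \<noteq> 0" using snd_ne_0_iff_not_north_pole[OF x(1)] x(2) by simp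
  have "{..k} = insert k {..<k}" by auto
  then have sum: "(\<Sum>l\<in>{..k}. coord_z l x * coord_z_star l x)
    = coord_z k x * coord_z_star k x + (\<Sum>l\<in>{..<k}. coord_z l x * coord_z_star l x)" by simp
  have "(\<Sum>l\<in>{..<k}. coord_a l x * coord_a_star l x)
    = (coord_t x)\<^sup>2 * (\<Sum>l\<in>{..<k}. coord_z l x * coord_z_star l x)"
    unfolding sum_distrib_left coord_a_eq_z[OF t] coord_a_star_eq_z[OF t]
    by (simp add: power2_eq_square mult_ac)
  then have "(coord_t x)\<^sup>2 * local_bracket even_sphere br (coord_z k) (coord_z_star k) x
    = (coord_t x)\<^sup>2 * (2 * (1 + (\<Sum>l\<in>{..k}. coord_z l x * coord_z_star l x)))"
    by (subst local_quotient_bracket[OF x Cinf_on_coord_z coord_a_eq_z[symmetric] smooth_coord_a Cinf_on_coord_z_star coord_a_star_eq_z[symmetric] smooth_coord_a_star])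
      (auto simp: br_a_a_star_same[OF x(1)] br_a_t[OF x(1)] br_t_a_star[OF x(1)] coord_a_eq_z[OF t, of k]
        coord_a_star_eq_z[OF t, of k] sum power2_eq_square algebra_simps)
  then show ?thesis using t by (simp add: coord_t_def)
qed

end

theorem proposition2:
  fixes br :: "((complex ^ 'n::{finite,linorder}) \<times> real \<Rightarrow> complex) \<Rightarrow>
               ((complex ^ 'n::{finite,linorder}) \<times> real \<Rightarrow> complex) \<Rightarrow> (complex ^ 'n::{finite,linorder}) \<times> real \<Rightarrow> complex"
  assumes "poisson_bracket_on even_sphere br"
    and "\<And>k l x. k < l \<Longrightarrow> x \<in> even_sphere \<Longrightarrow>
           br (coord_a k) (coord_a l) x = coord_a k x * coord_a l x"
    and "\<And>k l x. k \<noteq> l \<Longrightarrow> x \<in> even_sphere \<Longrightarrow>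
           br (coord_a k) (coord_a_star l) x = - 3 * coord_a k x * coord_a_star l x"
    and "\<And>i x. x \<in> even_sphere \<Longrightarrow>
           br (coord_a i) coord_t x = - 2 * coord_a i x * coord_t x"
    and "\<And>k x. x \<in> even_sphere \<Longrightarrow>
           br (coord_a k) (coord_a_star k) x =
             2 * (coord_t x)\<^sup>2 + 2 * (\<Sum>l\<in>{..<k}. coord_a l x * coord_a_star l x)
               - 2 * coord_a k x * coord_a_star k x"
  shows "symplectic_leaves even_sphere br = {{north_pole}, even_sphere - {north_pole}} \<and>
    {north_pole} \<noteq> (even_sphere - {north_pole} :: ((complex ^ 'n::{finite,linorder}) \<times> real) set) \<and>
    leaf_dimension even_sphere br {north_pole} 0 \<and>
    leaf_dimension even_sphere br (even_sphere - {north_pole}) (2 * CARD('n)) \<and>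
    diffeomorphism_between (even_sphere - {north_pole}) (UNIV :: (complex ^ 'n::{finite,linorder}) set)
      (\<lambda>x. \<chi> i. coord_z i x) \<and>
    (\<forall>x\<in>even_sphere - {north_pole}.
      (\<forall>k l. k < l \<longrightarrow>
         local_bracket even_sphere br (coord_z k) (coord_z l) x = coord_z k x * coord_z l x) \<and>
      (\<forall>k l. k \<noteq> l \<longrightarrow>
         local_bracket even_sphere br (coord_z k) (coord_z_star l) x
           = coord_z k x * coord_z_star l x) \<and>
      (\<forall>k. local_bracket even_sphere br (coord_z k) (coord_z_star k) x
           = 2 * (1 + (\<Sum>l\<in>{..k}. coord_z l x * coord_z_star l x))))"
proof -
  interpret sphere_poisson br
    using assms by unfold_locales
  have "unchart 0 \<in> even_sphere - {north_pole}" by (rule unchart_in)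
  then have "{north_pole} \<noteq> (even_sphere - {north_pole} :: ((complex, 'n) vec \<times> real) set)" by blast
  with symplectic_leaves_sphere leaf_dimension_pole leaf_dimension_regular diffeomorphism_chart
  show ?thesis
    by (intro conjI ballI allI impI)
      (assumption | rule local_bracket_z_z local_bracket_z_z_star local_bracket_z_z_star_same; simp)+
qed

end
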